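(* Let $\xi$ be a real random variable with zero mean and unit variance. For every $n\in\mathbb{N}$ let $X_n$ be a random vector in $\mathbb{R}^n$, and suppose that the coordinates $((X_n)_k)_{1\le k\le n,\,n\in\mathbb{N}}$ are i.i.d. and distributed as $\xi$. Then the following hold. (1) $\displaystyle\lim_{M\to\infty}\ \sup_{n\in\mathbb{N},\,y\in S^{n-1}}\mathbb{E}\bigl(\langle X_n,y\rangle^2\mathbf{1}_{\{\langle X_n,y\rangle^2\ge M\}}\bigr)=0$, and there exist functions $f:\mathbb{N}\to[0,1]$ and $g:\mathbb{N}\to\mathbb{R}_+$ with $f(r)\to0$ and $g(r)\to0$ as $r\to\infty$ such that for every $n\in\mathbb{N}$ and every orthogonal projection $P:\mathbb{R}^n\to\mathbb{R}^n$ with $P\ne0$, writing $r:=\operatorname{rank}P$, $$\mathbb{P}\bigl(\bigl|\|PX_n\|^2-r\bigr|\ge f(r)r\bigr)\le g(r).$$ (2) If moreover $\mathbb{E}(\xi^4)<\infty$, then there exist functions $f:\mathbb{N}\to[0,1]$ and $g:\mathbb{N}\to\mathbb{R}_+$ with $f(r)\to0$ and $g(r)\to0$ as $r\to\infty$ such that for every $n\in\mathbb{N}$, every orthogonal projection $P:\mathbb{R}^n\to\mathbb{R}^n$ with $P\ne0$, writing $r:=\operatorname{rank}P$, and every real $t\ge f(r)r$, $$\mathbb{P}\bigl(\bigl|\|PX_n\|^2-r\bigr|\ge t\bigr)\le\frac{g(r)\,r}{t^2}.$$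
   Context: $\mathbb{N}=\{1,2,\ldots\}$, $\mathbb{R}_+=[0,\infty)$. $\|\cdot\|$ is the Euclidean norm and $S^{n-1}=\{y\in\mathbb{R}^n:\|y\|=1\}$. If $f(r)=0$, the inequality in (2) at $t=0$ is to be read as imposing no condition. *)

theory Defs
  imports
    "HOL-Probability.Probability"
    "Jordan_Normal_Form.DL_Rank"
    "Jordan_Normal_Form.Matrix_Kernel"
begin

unbundle no vec_syntax
no_notation inner (infix "\<bullet>" 70)

text \<open>
  Euclidean n-space is \<open>carrier_vec n :: real Matrix.vec set\<close>, since one
  statement has to range over all dimensions n; linear maps are given by their matrices.
\<close>

definition euclid_norm :: "real Matrix.vec \<Rightarrow> real" where
  "euclid_norm v = sqrt (v \<bullet> v)"

definition unit_sphere :: "nat \<Rightarrow> real Matrix.vec set" where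
  "unit_sphere n = {y \<in> carrier_vec n. euclid_norm y = 1}"

definition orthogonal_projection :: "nat \<Rightarrow> real mat \<Rightarrow> bool" where
  "orthogonal_projection n P \<longleftrightarrow>
     P \<in> carrier_mat n n \<and> P * P = P \<and>
     (\<forall>x \<in> carrier_vec n. \<forall>v \<in> mat_kernel P. (P *\<^sub>v x) \<bullet> v = 0)"

text \<open>
  Rate functions live on \<open>{1, 2, \<dots>}\<close>, so their value at 0 is left free.
\<close>

definition rate_pair :: "(nat \<Rightarrow> real) \<Rightarrow> (nat \<Rightarrow> real) \<Rightarrow> bool" where
  "rate_pair f g \<longleftrightarrow>
     f \<in> {1..} \<rightarrow> {0..1} \<and> g \<in> {1..} \<rightarrow> {0..} \<and> f \<longlonglongrightarrow> 0 \<and> g \<longlonglongrightarrow> 0"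

text \<open>
  Coordinates are indexed from 0, so the index set of the whole triangular array is
  \<open>{(n, k). 1 \<le> n \<and> k < n}\<close>. Independence is joint over the entire array, i.e. also across
  different n. \<open>indep_vars\<close> includes measurability of every coordinate.
\<close>

definition iid_array ::
    "'a measure \<Rightarrow> (nat \<Rightarrow> 'a \<Rightarrow> real Matrix.vec) \<Rightarrow> real measure \<Rightarrow> bool" where
  "iid_array M X D \<longleftrightarrow>
     (\<forall>n\<ge>1. \<forall>\<omega>\<in>space M. X n \<omega> \<in> carrier_vec n) \<and>
     prob_space.indep_vars M (\<lambda>_. borel) (\<lambda>(n, k) \<omega>. X n \<omega> $ k) {(n, k). 1 \<le> n \<and> k < n} \<and>
     (\<forall>n\<ge>1. \<forall>k<n. distr M borel (\<lambda>\<omega>. X n \<omega> $ k) = D)"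

end

theory Submission
  imports Defs "HOL-Real_Asymp.Real_Asymp"
begin

text \<open>
  Let \<open>x\<close> be the coordinates of \<open>X n\<close>. A projection \<open>P\<close> of rank \<open>r\<close> is symmetric with trace
  \<open>r\<close>, diagonal entries in \<open>[0,1]\<close> and sum of squared entries \<open>r\<close>, and the deviation of the
  squared norm of \<open>P x\<close> from \<open>r\<close> is the linear form with coefficients \<open>P\<^sub>i\<^sub>i\<close> in the variables
  \<open>x\<^sub>i\<^sup>2 - 1\<close> plus twice the strictly lower triangular quadratic form of \<open>P\<close>.
  Every variable is split into a bounded centred part and a centred remainder that is small in
  mean (square). Remainders contribute little to the first or second moment. For bounded
  variables both forms are sums of martingale increments \<open>h x\<^sub>m * T\<close> with \<open>T\<close> depending on
  earlier coordinates only, and an induction bounds the fourth moment by a constant times the square of the sum of squared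
  coefficients. Chebyshev and fourth-moment Markov bounds, with the truncation level tending
  slowly to infinity, then give all three claims.
\<close>

subsection \<open>Orthogonal projections\<close>

lemma mult_mat_unit_vec:
  fixes A :: "'a::semiring_1 mat"
  assumes "A \<in> carrier_mat m n" "i < n"
  shows "A *\<^sub>v unit_vec n i = col A i"
  using assms by (intro eq_vecI) (auto simp: scalar_prod_right_unit[of _ n])

text \<open>Full-rank factorisation: \<open>P = C * F\<close>, where the columns of \<open>C\<close>
  are a basis of the column space taken from the columns of \<open>P\<close> and \<open>F\<close>
  holds the coordinates of all columns in it. Idempotence forces \<open>F * C = 1\<^sub>m r\<close>,
  and swapping the factors under the trace gives \<open>r\<close>.\<close>

lemma rank_idempotent_eq_trace:
  fixes P :: "'a::field mat"
  assumes P: "P \<in> carrier_mat n n" and idem: "P * P = P"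
  shows "of_nat (vec_space.rank n P) = (\<Sum>i<n. P $$ (i,i))"
proof -
  interpret vec_space "TYPE('a)" n .
  obtain S where S: "finite S" "maximal S (\<lambda>T. T \<subseteq> set (cols P) \<and> lin_indpt T)"
    using maximal_exists_superset[of "set (cols P)" "\<lambda>T. T \<subseteq> set (cols P) \<and> lin_indpt T" "{}"]
    by (meson List.finite_set empty_subsetI finite_lin_indpt2 finite.emptyI empty_iff)
  have cP: "set (cols P) \<subseteq> carrier_vec n" using P cols_dim by blast
  have SP: "S \<subseteq> set (cols P)" and li: "lin_indpt S" using S(2) by (auto simp: maximal_def)
  have Sc: "S \<subseteq> carrier_vec n" using SP cP by auto
  obtain bs where bs: "set bs = S" "distinct bs" using finite_distinct_list[OF S(1)] by auto
  define r where "r = length bs"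
  have rank: "rank P = r"
    using rank_card_indpt[OF P S(2)] bs distinct_card[of bs] by (simp add: r_def)
  define C where "C = mat_of_cols n bs"
  have C: "C \<in> carrier_mat n r" unfolding C_def r_def by simp
  have colsC: "cols C = bs" unfolding C_def using bs Sc by (intro cols_mat_of_cols) auto
  \<comment> \<open>By maximality of \<open>S\<close>, a column outside \<open>span S\<close> could
    be added to \<open>S\<close> without losing independence.\<close>
  have "\<exists>f. f \<in> carrier_vec r \<and> C *\<^sub>v f = col P j" if j: "j < n" for j
  proof -
    have jP: "col P j \<in> set (cols P)" using j P
      by (metis carrier_matD(2) cols_length cols_nth nth_mem)
    have "col P j \<in> span S"
    proof (rule ccontr)
      assume nin: "col P j \<notin> span S"
      then have "lin_indpt (insert (col P j) S)"
        using lin_dep_iff_in_span[OF Sc li, of "col P j"] jP cP span_mem[OF Sc]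
        by (metis Un_insert_right subset_eq sup_bot_right)
      then have "insert (col P j) S = S"
        using S(2) jP SP unfolding maximal_def by blast
      then show False using nin span_mem[OF Sc] by blast
    qed
    then obtain a where "col P j = lincomb a S"
      using finite_span[OF S(1)] Sc by auto
    also have "\<dots> = lincomb_list (\<lambda>i. a (bs ! i)) bs"
      using lincomb_as_lincomb_list_distinct[of bs a] bs Sc by simp
    also have "\<dots> = C *\<^sub>v vec r (\<lambda>i. a (bs ! i))"
      unfolding C_def r_def using bs Sc by (intro lincomb_list_as_mat_mult) auto
    finally show ?thesis by (metis vec_carrier)
  qed
  then obtain f where f: "\<And>j. j < n \<Longrightarrow> f j \<in> carrier_vec r" "\<And>j. j < n \<Longrightarrow> C *\<^sub>v f j = col P j"
    by metis
  define F where "F = mat_of_cols r (map f [0..<n])"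
  have F: "F \<in> carrier_mat r n" unfolding F_def by (metis diff_zero length_map length_upt mat_of_cols_carrier(1))
  have colF: "col F j = f j" if "j < n" for j
    unfolding F_def using that f(1) by (subst col_mat_of_cols) auto
  have PCF: "P = C * F"
  proof (rule mat_col_eqI)
    fix j assume "j < dim_col (C * F)"
    then have j: "j < n" using F by simp
    show "col P j = col (C * F) j"
      using f(2)[OF j] colF[OF j] col_mult2[OF C F j] by simp
  qed (use P C F in auto)
  \<comment> \<open>The columns of \<open>C\<close> are columns of \<open>P\<close>, and
    \<open>P * P = P\<close> says that \<open>P\<close> fixes its own columns.\<close>
  have PC: "P *\<^sub>v col C i = col C i" if i: "i < r" for i
  proof -
    have "col C i \<in> set (cols P)" using SP bs(1) i C colsC
      by (metis carrier_matD(2) cols_length cols_nth nth_mem subset_eq)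
    then obtain k where k: "k < n" "col C i = col P k" using P by (auto simp: cols_def)
    show ?thesis using col_mult2[OF P P k(1)] k(2) idem by simp
  qed
  \<comment> \<open>\<open>C\<close> sends column \<open>i\<close> of \<open>F * C\<close> and the
    unit vector \<open>i\<close> to the same vector, and \<open>C\<close> is injective because its
    columns are independent.\<close>
  have FC: "F * C = 1\<^sub>m r"
  proof (rule mat_col_eqI)
    fix i assume "i < dim_col (1\<^sub>m r :: 'a mat)"
    then have i: "i < r" by simp
    have cFC: "col (F * C) i \<in> carrier_vec r" using F C i by auto
    have u: "unit_vec r i \<in> carrier_vec r" by simp
    have CC: "C *\<^sub>v col (F * C) i = col C i"
    proof -
      have "C *\<^sub>v (F *\<^sub>v col C i) = C * F *\<^sub>v col C i"
        using C F i by (intro assoc_mult_mat_vec[symmetric]) auto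
      then show ?thesis using PC[OF i] col_mult2[OF F C i] PCF by simp
    qed
    have Cu: "C *\<^sub>v unit_vec r i = col C i"
      using mult_mat_unit_vec[OF C i] .
    have "C *\<^sub>v (col (F * C) i - unit_vec r i) = 0\<^sub>v n"
      using mult_minus_distrib_mat_vec[OF C cFC u] CC Cu C i
      by (simp add: minus_cancel_vec)
    moreover have "col (F * C) i - unit_vec r i \<in> carrier_vec r" using cFC by simp
    ultimately have "col (F * C) i - unit_vec r i = 0\<^sub>v r"
      using lin_depI[OF C] li bs colsC by metis
    then have "(col (F * C) i - unit_vec r i) $ k = 0" if "k < r" for k
      using that by simp
    then show "col (F * C) i = col (1\<^sub>m r) i"
      using cFC i F C by (intro eq_vecI) auto
  qed (use C F in auto)
  have "(\<Sum>i<n. P $$ (i,i)) = (\<Sum>i<n. \<Sum>k<r. C $$ (i,k) * F $$ (k,i))"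
    unfolding PCF using C F by (intro sum.cong refl) (auto simp: scalar_prod_def atLeast0LessThan)
  also have "\<dots> = (\<Sum>k<r. \<Sum>i<n. F $$ (k,i) * C $$ (i,k))"
    by (subst sum.swap) (simp add: mult.commute)
  also have "\<dots> = (\<Sum>k<r. (F * C) $$ (k,k))"
    using C F by (intro sum.cong refl) (auto simp: scalar_prod_def atLeast0LessThan)
  also have "\<dots> = of_nat r" unfolding FC by simp
  finally show ?thesis using rank by simp
qed

text \<open>The vector \<open>y - P *\<^sub>v y\<close> lies in the kernel, hence is orthogonal to
  the range. The right side is symmetric in \<open>x\<close> and \<open>y\<close>, so this also
  yields self-adjointness.\<close>

lemma orthogonal_projection_adjoint:
  assumes P: "orthogonal_projection n P" and x: "x \<in> carrier_vec n" and y: "y \<in> carrier_vec n"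
  shows "(P *\<^sub>v x) \<bullet> y = (P *\<^sub>v x) \<bullet> (P *\<^sub>v y)"
proof -
  have Pc: "P \<in> carrier_mat n n" and idem: "P * P = P"
    and orth: "\<And>x v. x \<in> carrier_vec n \<Longrightarrow> v \<in> mat_kernel P \<Longrightarrow> (P *\<^sub>v x) \<bullet> v = 0"
    using P by (auto simp: orthogonal_projection_def)
  have Py: "P *\<^sub>v y \<in> carrier_vec n" and Px: "P *\<^sub>v x \<in> carrier_vec n" using Pc x y by auto
  have "P *\<^sub>v (y - P *\<^sub>v y) = 0\<^sub>v n"
    using mult_minus_distrib_mat_vec[OF Pc y Py] assoc_mult_mat_vec[OF Pc Pc y] idem Py by simp
  then have "y - P *\<^sub>v y \<in> mat_kernel P"
    using Pc y by (intro mat_kernelI[OF Pc]) auto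
  from orth[OF x this] show ?thesis
    using scalar_prod_minus_distrib[OF Px y Py] by simp
qed

lemma orthogonal_projection_symmetric:
  assumes P: "orthogonal_projection n P" and i: "i < n" and j: "j < n"
  shows "P $$ (i,j) = P $$ (j,i)"
proof -
  have Pc: "P \<in> carrier_mat n n" using P by (simp add: orthogonal_projection_def)
  have e: "(P *\<^sub>v unit_vec n b) \<bullet> unit_vec n a = P $$ (a,b)" if "a < n" "b < n" for a b
    using that Pc mult_mat_unit_vec[OF Pc] by (simp add: scalar_prod_right_unit[of _ n])
  have "P *\<^sub>v unit_vec n k \<in> carrier_vec n" for k using Pc by simp
  then have "(P *\<^sub>v unit_vec n j) \<bullet> unit_vec n i = (P *\<^sub>v unit_vec n i) \<bullet> unit_vec n j"
    using orthogonal_projection_adjoint[OF P, of "unit_vec n i" "unit_vec n j"]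
      orthogonal_projection_adjoint[OF P, of "unit_vec n j" "unit_vec n i"]
      comm_scalar_prod[of "P *\<^sub>v unit_vec n i" n "P *\<^sub>v unit_vec n j"] by simp
  then show ?thesis using e i j by simp
qed

lemma orthogonal_projection_norm:
  assumes P: "orthogonal_projection n P" and x: "x \<in> carrier_vec n"
  shows "(euclid_norm (P *\<^sub>v x))\<^sup>2 = (\<Sum>i<n. \<Sum>j<n. P $$ (i,j) * (x $ i * x $ j))"
proof -
  have Pc: "P \<in> carrier_mat n n" using P by (simp add: orthogonal_projection_def)
  have "(P *\<^sub>v x) \<bullet> (P *\<^sub>v x) \<ge> 0" by (simp add: scalar_prod_def sum_nonneg)
  then have "(euclid_norm (P *\<^sub>v x))\<^sup>2 = (P *\<^sub>v x) \<bullet> x"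
    using orthogonal_projection_adjoint[OF P x x] by (simp add: euclid_norm_def)
  also have "\<dots> = (\<Sum>i<n. \<Sum>j<n. P $$ (i,j) * (x $ i * x $ j))"
    using Pc x by (auto simp: scalar_prod_def atLeast0LessThan sum_distrib_right sum_distrib_left mult_ac intro!: sum.cong)
  finally show ?thesis .
qed

lemma orthogonal_projection_trace:
  assumes "orthogonal_projection n P"
  shows "(\<Sum>i<n. P $$ (i,i)) = real (vec_space.rank n P)"
  using assms rank_idempotent_eq_trace[of P n] by (simp add: orthogonal_projection_def)

text \<open>Compare diagonal entries in \<open>P = P * P\<close> and use symmetry. Summed over
  \<open>i\<close>, it makes the sum of all squared entries equal to the rank.\<close>

lemma orthogonal_projection_diag:
  assumes P: "orthogonal_projection n P" and i: "i < n"
  shows "P $$ (i,i) = (\<Sum>j<n. (P $$ (i,j))\<^sup>2)"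
proof -
  have Pc: "P \<in> carrier_mat n n" using P by (simp add: orthogonal_projection_def)
  have "P $$ (i,i) = (P * P) $$ (i,i)" using P by (simp add: orthogonal_projection_def)
  also have "\<dots> = (\<Sum>j<n. P $$ (i,j) * P $$ (j,i))"
    using Pc i by (simp add: scalar_prod_def atLeast0LessThan)
  also have "\<dots> = (\<Sum>j<n. (P $$ (i,j))\<^sup>2)"
    using orthogonal_projection_symmetric[OF P i] by (simp add: power2_eq_square)
  finally show ?thesis .
qed

text \<open>The diagonal entry is the squared norm of its row, and so it dominates its own
  square.\<close>

lemma orthogonal_projection_diag_bounds:
  assumes P: "orthogonal_projection n P" and i: "i < n"
  shows "0 \<le> P $$ (i,i)" "P $$ (i,i) \<le> 1"
proof -
  show nn: "0 \<le> P $$ (i,i)" unfolding orthogonal_projection_diag[OF P i] by (simp add: sum_nonneg)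
  have "(P $$ (i,i))\<^sup>2 \<le> (\<Sum>j<n. (P $$ (i,j))\<^sup>2)"
    using i by (intro member_le_sum) auto
  then have "P $$ (i,i) * P $$ (i,i) \<le> P $$ (i,i)"
    using orthogonal_projection_diag[OF P i] by (simp add: power2_eq_square)
  then show "P $$ (i,i) \<le> 1" using mult_less_cancel_right2[of "P $$ (i,i)" "P $$ (i,i)"] by (cases "P $$ (i,i) = 0") (use nn in \<open>auto simp: mult_le_cancel_right2\<close>)
qed

text \<open>Rank 0 means trace 0, so the nonnegative diagonal vanishes; each diagonal entry being a
  squared row norm, every row vanishes too.\<close>

lemma orthogonal_projection_rank_pos:
  assumes P: "orthogonal_projection n P" and "P \<noteq> 0\<^sub>m n n"
  shows "1 \<le> vec_space.rank n P"
proof (rule ccontr)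
  assume "\<not> 1 \<le> vec_space.rank n P"
  then have "(\<Sum>i<n. P $$ (i,i)) = 0" using orthogonal_projection_trace[OF P] by simp
  then have "\<forall>i\<in>{..<n}. P $$ (i,i) = 0"
    by (subst (asm) sum_nonneg_eq_0_iff) (auto intro: orthogonal_projection_diag_bounds[OF P])
  then have "\<forall>i<n. \<forall>j\<in>{..<n}. (P $$ (i,j))\<^sup>2 = 0"
    using orthogonal_projection_diag[OF P] by (simp add: sum_nonneg_eq_0_iff)
  then have "P = 0\<^sub>m n n"
    using P by (intro eq_matI) (auto simp: orthogonal_projection_def)
  with assms(2) show False by simp
qed

lemma orthogonal_projection_lower_triangle:
  assumes P: "orthogonal_projection n P"
  shows "(\<Sum>j<n. \<Sum>i<j. (P $$ (j,i))\<^sup>2) \<le> real (vec_space.rank n P)"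
proof -
  have "(\<Sum>j<n. \<Sum>i<j. (P $$ (j,i))\<^sup>2) \<le> (\<Sum>j<n. \<Sum>i<n. (P $$ (j,i))\<^sup>2)"
    by (intro sum_mono sum_mono2) auto
  also have "\<dots> = (\<Sum>j<n. P $$ (j,j))"
    using orthogonal_projection_diag[OF P] by simp
  finally show ?thesis using orthogonal_projection_trace[OF P] by simp
qed

lemma orthogonal_projection_diag_squares:
  assumes P: "orthogonal_projection n P"
  shows "(\<Sum>i<n. (P $$ (i,i))\<^sup>2) \<le> real (vec_space.rank n P)"
proof -
  have "(\<Sum>i<n. (P $$ (i,i))\<^sup>2) \<le> (\<Sum>i<n. P $$ (i,i))"
    using orthogonal_projection_diag_bounds[OF P]
    by (intro sum_mono) (simp add: power2_eq_square mult_left_le)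
  then show ?thesis using orthogonal_projection_trace[OF P] by simp
qed

subsection \<open>Moments of linear and quadratic forms\<close>

lemma integrable_mult_of_squares:
  fixes f g :: "'a \<Rightarrow> real"
  assumes [measurable]: "f \<in> borel_measurable M" "g \<in> borel_measurable M"
    and f: "integrable M (\<lambda>x. (f x)\<^sup>2)" and g: "integrable M (\<lambda>x. (g x)\<^sup>2)"
  shows "integrable M (\<lambda>x. f x * g x)"
proof (rule Bochner_Integration.integrable_bound[of M "\<lambda>x. (f x)\<^sup>2 + (g x)\<^sup>2"])
  show "AE x in M. norm (f x * g x) \<le> norm ((f x)\<^sup>2 + (g x)\<^sup>2)"
  proof (rule AE_I2)
    fix x
    have "2 * (\<bar>f x\<bar> * \<bar>g x\<bar>) \<le> (f x)\<^sup>2 + (g x)\<^sup>2"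
      using sum_squares_bound[of "\<bar>f x\<bar>" "\<bar>g x\<bar>"] by (simp add: mult.assoc)
    moreover have "0 \<le> \<bar>f x\<bar> * \<bar>g x\<bar>" by simp
    ultimately show "norm (f x * g x) \<le> norm ((f x)\<^sup>2 + (g x)\<^sup>2)"
      unfolding abs_mult real_norm_def by linarith
  qed
qed (use f g in auto)

lemma integrable_power2_add:
  fixes f g :: "'a \<Rightarrow> real"
  assumes [measurable]: "f \<in> borel_measurable M" "g \<in> borel_measurable M"
    and f: "integrable M (\<lambda>x. (f x)\<^sup>2)" and g: "integrable M (\<lambda>x. (g x)\<^sup>2)"
  shows "integrable M (\<lambda>x. (f x + g x)\<^sup>2)"
  using integrable_mult_of_squares[OF assms] f g
  by (auto simp: power2_sum mult.assoc)

lemma integral_mult_square_le: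
  fixes f g :: "'a \<Rightarrow> real"
  assumes [measurable]: "f \<in> borel_measurable M" "g \<in> borel_measurable M"
    and f: "integrable M (\<lambda>x. (f x)\<^sup>2)" and g: "integrable M (\<lambda>x. (g x)\<^sup>2)"
  shows "(\<integral>x. f x * g x \<partial>M)\<^sup>2 \<le> (\<integral>x. (f x)\<^sup>2 \<partial>M) * (\<integral>x. (g x)\<^sup>2 \<partial>M)"
proof -
  define a b e where "a = (\<integral>x. (f x)\<^sup>2 \<partial>M)" and "b = (\<integral>x. (g x)\<^sup>2 \<partial>M)"
    and "e = (\<integral>x. f x * g x \<partial>M)"
  have fg: "integrable M (\<lambda>x. f x * g x)" by (rule integrable_mult_of_squares[OF assms])
  \<comment> \<open>The Gram form of \<open>f\<close> and \<open>g\<close> is nonnegative; the two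
    cases below evaluate it at suitable points.\<close>
  have q: "0 \<le> s\<^sup>2 * a - 2 * s * t * e + t\<^sup>2 * b" for s t
  proof -
    have "0 \<le> (\<integral>x. (s * f x - t * g x)\<^sup>2 \<partial>M)" by simp
    also have "\<dots> = (\<integral>x. s\<^sup>2 * (f x)\<^sup>2 - 2 * s * t * (f x * g x) + t\<^sup>2 * (g x)\<^sup>2 \<partial>M)"
      by (intro Bochner_Integration.integral_cong) (auto simp: power2_eq_square algebra_simps)
    also have "\<dots> = s\<^sup>2 * a - 2 * s * t * e + t\<^sup>2 * b"
      using f g fg by (simp add: a_def b_def e_def)
    finally show ?thesis .
  qed
  have b: "0 \<le> b" unfolding b_def by simp
  have "e\<^sup>2 \<le> a * b"
  proof (cases "b = 0")
    case True
    have "e = 0"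
      \<comment> \<open>With \<open>b = 0\<close> and \<open>e\<close> nonzero the form would take
        the value \<open>a - (a + 1) = -1\<close> here.\<close>
      using q[of 1 "(a + 1) / (2 * e)"] True by (cases "e = 0") (auto simp: field_simps)
    then show ?thesis using True by simp
  next
    case False
    have "0 \<le> b * (a * b - e\<^sup>2)"
      using q[of b e] by (simp add: power2_eq_square algebra_simps)
    then show ?thesis using b False by (simp add: zero_le_mult_iff)
  qed
  then show ?thesis by (simp add: a_def b_def e_def)
qed

text \<open>Functions of the first \<open>m\<close> coordinates, kept as functions on all sequences
  so that forms of different lengths share one type. Invariance under \<open>restrict\<close> lets
  them be read as functions of the restricted vector, which is what the independence of blocks of
  coordinates is about.\<close>

definition past :: "nat \<Rightarrow> ((nat \<Rightarrow> real) \<Rightarrow> real) \<Rightarrow> bool" where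
  "past m G \<longleftrightarrow> G \<in> borel_measurable (\<Pi>\<^sub>M i\<in>{..<m}. borel) \<and> (\<forall>z. G (restrict z {..<m}) = G z)"

definition lin :: "(nat \<Rightarrow> real) \<Rightarrow> (real \<Rightarrow> real) \<Rightarrow> nat \<Rightarrow> (nat \<Rightarrow> real) \<Rightarrow> real" where
  "lin c h m z = (\<Sum>i<m. c i * h (z i))"

text \<open>
  Each coordinate is paired with earlier ones only, so \<open>quad\<close> is a martingale in \<open>m\<close>
  when evaluated on centred independent coordinates.
\<close>

definition quad ::
    "(nat \<Rightarrow> nat \<Rightarrow> real) \<Rightarrow> (real \<Rightarrow> real) \<Rightarrow> (real \<Rightarrow> real) \<Rightarrow> nat \<Rightarrow> (nat \<Rightarrow> real) \<Rightarrow> real" where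
  "quad c h k m z = (\<Sum>j<m. k (z j) * lin (c j) h j z)"

lemma past_const [intro]: "past m (\<lambda>_. c)"
  by (simp add: past_def)

lemma past_mult [intro]: "past m G \<Longrightarrow> past m H \<Longrightarrow> past m (\<lambda>z. G z * H z)"
  unfolding past_def by (auto intro: borel_measurable_times)

lemma past_power [intro]: "past m G \<Longrightarrow> past m (\<lambda>z. G z ^ k)"
  unfolding past_def by (auto intro: borel_measurable_power)

lemma past_sum: "(\<And>i. i \<in> I \<Longrightarrow> past m (G i)) \<Longrightarrow> past m (\<lambda>z. \<Sum>i\<in>I. G i z)"
  unfolding past_def by (auto intro: borel_measurable_sum)

lemma past_coord:
  assumes h: "h \<in> borel_measurable borel" and i: "i < m"
  shows "past m (\<lambda>z. h (z i))"
proof -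
  have "(\<lambda>z. z i) \<in> measurable (\<Pi>\<^sub>M i\<in>{..<m}. borel) borel"
    using i by (intro measurable_component_singleton) simp
  from measurable_compose[OF this h] show ?thesis using i by (simp add: past_def)
qed

lemma past_lin:
  assumes "h \<in> borel_measurable borel" "l \<le> m"
  shows "past m (lin c h l)"
  unfolding lin_def using assms by (intro past_sum past_mult past_const past_coord) auto

lemma past_quad:
  assumes "h \<in> borel_measurable borel" "k \<in> borel_measurable borel" "l \<le> m"
  shows "past m (quad c h k l)"
  unfolding quad_def using assms by (intro past_sum past_mult past_lin past_coord) auto

text \<open>The bound may depend on \<open>m\<close> and \<open>c\<close>; it serves only to make
  all powers integrable in the fourth moment recursion.\<close>

lemma lin_bounded:
  assumes "\<And>x. \<bar>h x\<bar> \<le> B"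
  shows "\<exists>K. \<forall>z. \<bar>lin c h m z\<bar> \<le> K"
proof (intro exI allI)
  fix z show "\<bar>lin c h m z\<bar> \<le> (\<Sum>i<m. \<bar>c i\<bar> * B)"
    unfolding lin_def
    by (rule order_trans[OF sum_abs]) (auto simp: abs_mult intro!: sum_mono mult_left_mono assms)
qed

lemma quad_bounded:
  assumes h: "\<And>x. \<bar>h x\<bar> \<le> B" and k: "\<And>x. \<bar>k x\<bar> \<le> B"
  shows "\<exists>K. \<forall>z. \<bar>quad c h k m z\<bar> \<le> K"
proof -
  have "\<forall>j. \<exists>K. \<forall>z. \<bar>lin (c j) h j z\<bar> \<le> K"
    using lin_bounded[of h B, OF h] by blast
  then obtain K where K: "\<And>j z. \<bar>lin (c j) h j z\<bar> \<le> K j" by metis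
  have B: "0 \<le> B" using h[of 0] by linarith
  show ?thesis
  proof (intro exI allI)
    fix z show "\<bar>quad c h k m z\<bar> \<le> (\<Sum>j<m. B * K j)"
      unfolding quad_def
      by (rule order_trans[OF sum_abs]) (auto simp: abs_mult intro!: sum_mono mult_mono K k B)
  qed
qed

section \<open>Moments of forms in independent coordinates with common law \<open>D\<close>\<close>

locale iid_sample = prob_space M for M :: "'a measure" +
  fixes n :: nat and Y :: "nat \<Rightarrow> 'a \<Rightarrow> real" and D :: "real measure"
  assumes indep: "indep_vars (\<lambda>_. borel) Y {..<n}"
    and distr_Y: "\<And>i. i < n \<Longrightarrow> distr M borel (Y i) = D"
    and prob_space_D: "prob_space D"
    and sets_D [measurable_cong]: "sets D = sets borel"
begin

sublocale D: prob_space D by (rule prob_space_D)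

abbreviation Z :: "'a \<Rightarrow> nat \<Rightarrow> real" where "Z \<omega> \<equiv> \<lambda>i. Y i \<omega>"

lemma Y_measurable: "i < n \<Longrightarrow> Y i \<in> borel_measurable M"
  using indep by (auto simp: indep_vars_def)

lemma integral_Y:
  assumes "i < n" "h \<in> borel_measurable borel"
  shows "(\<integral>\<omega>. h (Y i \<omega>) \<partial>M) = (\<integral>x. (h x :: real) \<partial>D)"
  using integral_distr[OF Y_measurable[OF assms(1)] assms(2)] distr_Y[OF assms(1)] by simp

lemma integrable_Y:
  assumes "i < n" "h \<in> borel_measurable borel"
  shows "integrable M (\<lambda>\<omega>. (h (Y i \<omega>) :: real)) \<longleftrightarrow> integrable D h"
  using integrable_distr_eq[OF Y_measurable[OF assms(1)] assms(2)] distr_Y[OF assms(1)] by simp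

lemma past_measurable:
  assumes "past m G" "m \<le> n"
  shows "(\<lambda>\<omega>. G (Z \<omega>)) \<in> borel_measurable M"
proof -
  have "(\<lambda>\<omega>. restrict (Z \<omega>) {..<m}) \<in> measurable M (\<Pi>\<^sub>M i\<in>{..<m}. borel)"
    using assms Y_measurable by (intro measurable_restrict) auto
  from measurable_compose[OF this, of G borel] show ?thesis using assms(1) by (simp add: past_def)
qed

lemma past_integrable_bounded:
  assumes "past m G" "m \<le> n" "\<And>z. \<bar>G z\<bar> \<le> K"
  shows "integrable M (\<lambda>\<omega>. G (Z \<omega>))"
  by (rule integrable_const_bound[of _ K]) (use assms past_measurable in auto)

lemma past_integrable_power:
  assumes G: "past m G" and m: "m \<le> n" and K: "\<exists>K. \<forall>z. \<bar>G z\<bar> \<le> K"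
  shows "integrable M (\<lambda>\<omega>. G (Z \<omega>) ^ k)"
proof -
  obtain K where "\<And>z. \<bar>G z\<bar> \<le> K" using K by auto
  then show ?thesis
    by (intro past_integrable_bounded[OF past_power[OF G] m, of _ "K ^ k"])
      (simp add: power_abs power_mono)
qed

text \<open>The block of coordinates below \<open>m\<close> is independent of coordinate
  \<open>m\<close>, so the expectation factorises. The moment recursions for increments
  \<open>h (Y m \<omega>) * T (Z \<omega>)\<close> use independence through this fact.\<close>

lemma past_present:
  assumes G: "past m G" and m: "m < n" and h: "h \<in> borel_measurable borel"
    and iG: "integrable M (\<lambda>\<omega>. G (Z \<omega>))" and ih: "integrable D h"
  shows "integrable M (\<lambda>\<omega>. G (Z \<omega>) * h (Y m \<omega>))"
    and "(\<integral>\<omega>. G (Z \<omega>) * h (Y m \<omega>) \<partial>M) = (\<integral>\<omega>. G (Z \<omega>) \<partial>M) * (\<integral>x. h x \<partial>D)"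
proof -
  have Gm: "G \<in> borel_measurable (\<Pi>\<^sub>M i\<in>{..<m}. borel)" and Gr: "\<And>z. G (restrict z {..<m}) = G z"
    using G by (auto simp: past_def)
  have "indep_var (\<Pi>\<^sub>M i\<in>{..<m}. borel) (\<lambda>\<omega>. restrict (Z \<omega>) {..<m})
      (\<Pi>\<^sub>M i\<in>{m}. borel) (\<lambda>\<omega>. restrict (Z \<omega>) {m})"
    using m by (intro indep_var_restrict[OF indep]) auto
  from indep_var_compose[OF this Gm, of "\<lambda>z. h (z m)" borel]
  have iv: "indep_var borel (\<lambda>\<omega>. G (Z \<omega>)) borel (\<lambda>\<omega>. h (Y m \<omega>))"
    using h by (simp add: comp_def Gr measurable_compose[OF measurable_component_singleton])
  have ihY: "integrable M (\<lambda>\<omega>. h (Y m \<omega>))" using integrable_Y[OF m h] ih by simp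
  show "integrable M (\<lambda>\<omega>. G (Z \<omega>) * h (Y m \<omega>))"
    by (rule indep_var_integrable[OF iv iG ihY])
  show "(\<integral>\<omega>. G (Z \<omega>) * h (Y m \<omega>) \<partial>M) = (\<integral>\<omega>. G (Z \<omega>) \<partial>M) * (\<integral>x. h x \<partial>D)"
    using indep_var_lebesgue_integral[OF iv iG ihY] integral_Y[OF m h] by simp
qed

text \<open>The increment is orthogonal to \<open>S\<close>: the cross term factorises and contains
  the mean of \<open>h\<close>, which is 0.\<close>

lemma second_moment_step:
  assumes S: "past m S" and T: "past m T" and m: "m < n" and h: "h \<in> borel_measurable borel"
    and S2: "integrable M (\<lambda>\<omega>. (S (Z \<omega>))\<^sup>2)" and T2: "integrable M (\<lambda>\<omega>. (T (Z \<omega>))\<^sup>2)"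
    and h2: "integrable D (\<lambda>x. (h x)\<^sup>2)" and h0: "(\<integral>x. h x \<partial>D) = 0"
  shows "integrable M (\<lambda>\<omega>. (S (Z \<omega>) + h (Y m \<omega>) * T (Z \<omega>))\<^sup>2)"
    and "(\<integral>\<omega>. (S (Z \<omega>) + h (Y m \<omega>) * T (Z \<omega>))\<^sup>2 \<partial>M)
      = (\<integral>\<omega>. (S (Z \<omega>))\<^sup>2 \<partial>M) + (\<integral>x. (h x)\<^sup>2 \<partial>D) * (\<integral>\<omega>. (T (Z \<omega>))\<^sup>2 \<partial>M)"
proof -
  have h1: "integrable D h"
    using D.square_integrable_imp_integrable[of h] h2 h by (simp add: measurable_def)
  have ST: "integrable M (\<lambda>\<omega>. S (Z \<omega>) * T (Z \<omega>))"
    using past_measurable[OF S] past_measurable[OF T] m S2 T2 by (intro integrable_mult_of_squares) auto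
  have e: "(S (Z \<omega>) + h (Y m \<omega>) * T (Z \<omega>))\<^sup>2
      = (S (Z \<omega>))\<^sup>2 + 2 * (S (Z \<omega>) * T (Z \<omega>) * h (Y m \<omega>)) + (T (Z \<omega>))\<^sup>2 * (h (Y m \<omega>))\<^sup>2" for \<omega>
    by (simp add: power2_eq_square algebra_simps)
  note p1 = past_present[OF past_mult[OF S T] m h ST h1]
  have h2m: "(\<lambda>x. (h x)\<^sup>2) \<in> borel_measurable borel" using h by simp
  note p2 = past_present[OF past_power[OF T] m h2m T2 h2]
  show "integrable M (\<lambda>\<omega>. (S (Z \<omega>) + h (Y m \<omega>) * T (Z \<omega>))\<^sup>2)"
    unfolding e using S2 p1(1) p2(1) by simp
  show "(\<integral>\<omega>. (S (Z \<omega>) + h (Y m \<omega>) * T (Z \<omega>))\<^sup>2 \<partial>M)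
      = (\<integral>\<omega>. (S (Z \<omega>))\<^sup>2 \<partial>M) + (\<integral>x. (h x)\<^sup>2 \<partial>D) * (\<integral>\<omega>. (T (Z \<omega>))\<^sup>2 \<partial>M)"
    unfolding e using S2 p1 p2 h0 by simp
qed

lemma lin_second_moment:
  assumes h: "h \<in> borel_measurable borel"
    and h2: "integrable D (\<lambda>x. (h x)\<^sup>2)" and h0: "(\<integral>x. h x \<partial>D) = 0"
  shows "m \<le> n \<Longrightarrow> integrable M (\<lambda>\<omega>. (lin c h m (Z \<omega>))\<^sup>2)"
    and "m \<le> n \<Longrightarrow> (\<integral>\<omega>. (lin c h m (Z \<omega>))\<^sup>2 \<partial>M) = (\<integral>x. (h x)\<^sup>2 \<partial>D) * (\<Sum>i<m. (c i)\<^sup>2)"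
proof (induction m)
  case 0
  { case 1 show ?case by (simp add: lin_def) }
  { case 2 show ?case by (simp add: lin_def) }
next
  case (Suc m)
  have e: "lin c h (Suc m) z = lin c h m z + h (z m) * c m" for z by (simp add: lin_def)
  { case 1
    then show ?case unfolding e using Suc h h2 h0
      by (intro second_moment_step past_lin past_const) auto }
  { case 2
    then show ?case unfolding e using Suc h h2 h0
      by (subst second_moment_step(2)[of m "lin c h m" "\<lambda>_. c m"])
        (auto intro!: past_lin simp: prob_space algebra_simps) }
qed

text \<open>The new increment has \<open>T = lin (c m) h m\<close>, whose second moment is already
  known. Two functions \<open>h\<close> and \<open>k\<close> are allowed because the remainder of a
  truncated form pairs different functions.\<close>

lemma quad_second_moment:
  assumes h: "h \<in> borel_measurable borel"
    and h2: "integrable D (\<lambda>x. (h x)\<^sup>2)" and h0: "(\<integral>x. h x \<partial>D) = 0"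
    and k: "k \<in> borel_measurable borel"
    and k2: "integrable D (\<lambda>x. (k x)\<^sup>2)" and k0: "(\<integral>x. k x \<partial>D) = 0"
  shows "m \<le> n \<Longrightarrow> integrable M (\<lambda>\<omega>. (quad c h k m (Z \<omega>))\<^sup>2)"
    and "m \<le> n \<Longrightarrow> (\<integral>\<omega>. (quad c h k m (Z \<omega>))\<^sup>2 \<partial>M)
      = (\<integral>x. (h x)\<^sup>2 \<partial>D) * (\<integral>x. (k x)\<^sup>2 \<partial>D) * (\<Sum>j<m. \<Sum>i<j. (c j i)\<^sup>2)"
proof (induction m)
  case 0
  { case 1 show ?case by (simp add: quad_def) }
  { case 2 show ?case by (simp add: quad_def) }
next
  case (Suc m)
  have e: "quad c h k (Suc m) z = quad c h k m z + k (z m) * lin (c m) h m z" for z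
    by (simp add: quad_def)
  { case 1
    then show ?case unfolding e using Suc h h2 h0 k k2 k0
      by (intro second_moment_step past_quad past_lin lin_second_moment) auto }
  { case 2
    then show ?case unfolding e using Suc h h2 h0 k k2 k0
      by (subst second_moment_step(2)[of m "quad c h k m" "lin (c m) h m"])
        (auto intro!: past_quad past_lin lin_second_moment(1) simp: lin_second_moment(2) algebra_simps) }
qed

text \<open>Just the triangle inequality. It serves for functions with a first moment only, such as
  the remainder of \<open>x\<^sup>2 - 1\<close> when no fourth moment is assumed.\<close>

lemma lin_first_moment:
  assumes h: "h \<in> borel_measurable borel" and h1: "integrable D h" and m: "m \<le> n"
  shows "integrable M (\<lambda>\<omega>. lin c h m (Z \<omega>))"
    and "(\<integral>\<omega>. \<bar>lin c h m (Z \<omega>)\<bar> \<partial>M) \<le> (\<integral>x. \<bar>h x\<bar> \<partial>D) * (\<Sum>i<m. \<bar>c i\<bar>)"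
proof -
  have ih: "integrable M (\<lambda>\<omega>. h (Y i \<omega>))" if "i < m" for i
    using integrable_Y[of i h] that m h h1 by auto
  then show i: "integrable M (\<lambda>\<omega>. lin c h m (Z \<omega>))"
    unfolding lin_def by (intro Bochner_Integration.integrable_sum integrable_mult_right) auto
  have "(\<integral>\<omega>. \<bar>lin c h m (Z \<omega>)\<bar> \<partial>M) \<le> (\<integral>\<omega>. (\<Sum>i<m. \<bar>c i\<bar> * \<bar>h (Y i \<omega>)\<bar>) \<partial>M)"
    using i ih unfolding lin_def
    by (intro integral_mono Bochner_Integration.integrable_sum integrable_mult_right integrable_abs)
      (auto intro!: order_trans[OF sum_abs] simp: abs_mult)
  also have "\<dots> = (\<Sum>i<m. \<bar>c i\<bar> * (\<integral>\<omega>. \<bar>h (Y i \<omega>)\<bar> \<partial>M))"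
    using ih by (subst Bochner_Integration.integral_sum) auto
  also have "\<dots> = (\<Sum>i<m. \<bar>c i\<bar> * (\<integral>x. \<bar>h x\<bar> \<partial>D))"
    using m h by (intro sum.cong refl) (subst integral_Y[of _ "\<lambda>x. \<bar>h x\<bar>"], auto)
  finally show "(\<integral>\<omega>. \<bar>lin c h m (Z \<omega>)\<bar> \<partial>M) \<le> (\<integral>x. \<bar>h x\<bar> \<partial>D) * (\<Sum>i<m. \<bar>c i\<bar>)"
    by (simp add: sum_distrib_left mult.commute)
qed

text \<open>
  For bounded coordinates the square root of the fourth moment grows by at most
  \<open>4 B\<^sup>2 v\<close> per martingale increment; this is what makes fourth moments of linear and
  quadratic forms additive in the squared coefficients.
\<close>

lemma fourth_moment_step:
  assumes S: "past m S" and T: "past m T" and m: "m < n" and h: "h \<in> borel_measurable borel"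
    and bS: "\<exists>K. \<forall>z. \<bar>S z\<bar> \<le> K" and bT: "\<exists>K. \<forall>z. \<bar>T z\<bar> \<le> K"
    and B: "\<And>x. \<bar>h x\<bar> \<le> B" and h0: "(\<integral>x. h x \<partial>D) = 0"
    and u: "(\<integral>\<omega>. (S (Z \<omega>)) ^ 4 \<partial>M) \<le> u\<^sup>2" "0 \<le> u"
    and v: "(\<integral>\<omega>. (T (Z \<omega>)) ^ 4 \<partial>M) \<le> v\<^sup>2" "0 \<le> v"
  shows "(\<integral>\<omega>. (S (Z \<omega>) + h (Y m \<omega>) * T (Z \<omega>)) ^ 4 \<partial>M) \<le> (u + 4 * B\<^sup>2 * v)\<^sup>2"
proof -
  obtain K L where K: "\<And>z. \<bar>S z\<bar> \<le> K" and L: "\<And>z. \<bar>T z\<bar> \<le> L" using bS bT by auto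
  have B0: "0 \<le> B" using B[of 0] by linarith
  have K0: "0 \<le> K" using K[of undefined] by linarith
  have pST: "past m (\<lambda>z. S z ^ i * T z ^ j)" for i j using S T by auto
  have iST: "integrable M (\<lambda>\<omega>. S (Z \<omega>) ^ i * T (Z \<omega>) ^ j)" for i j
    using m K L K0 by (intro past_integrable_bounded[OF pST, of _ _ "K ^ i * L ^ j"])
      (auto simp: abs_mult power_abs intro!: mult_mono power_mono)
  have hk: "(\<lambda>x. h x ^ k) \<in> borel_measurable borel" for k using h by simp
  have ih: "integrable D (\<lambda>x. h x ^ k)" for k
    by (rule D.integrable_const_bound[of _ "B ^ k"]) (use hk B in \<open>auto simp: power_abs power_mono\<close>)
  have Eh: "\<bar>\<integral>x. h x ^ k \<partial>D\<bar> \<le> B ^ k" for k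
  proof -
    have "\<bar>\<integral>x. h x ^ k \<partial>D\<bar> \<le> (\<integral>x. \<bar>h x ^ k\<bar> \<partial>D)" by (rule integral_abs_bound)
    also have "\<dots> \<le> (\<integral>x. B ^ k \<partial>D)"
      using B by (intro integral_mono integrable_abs[OF ih]) (auto simp: power_abs power_mono)
    finally show ?thesis by (simp add: D.prob_space)
  qed
  define E where "E i j = (\<integral>\<omega>. S (Z \<omega>) ^ i * T (Z \<omega>) ^ j \<partial>M)" for i j
  define H where "H k = (\<integral>x. h x ^ k \<partial>D)" for k
  define Q where "Q i j k \<omega> = S (Z \<omega>) ^ i * T (Z \<omega>) ^ j * h (Y m \<omega>) ^ k" for i j k \<omega>
  have p: "integrable M (Q i j k)" "(\<integral>\<omega>. Q i j k \<omega> \<partial>M) = E i j * H k" for i j k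
    using past_present[OF pST m hk iST ih] unfolding Q_def E_def H_def by blast+
  have e: "(S (Z \<omega>) + h (Y m \<omega>) * T (Z \<omega>)) ^ 4
      = Q 4 0 0 \<omega> + 4 * Q 3 1 1 \<omega> + 6 * Q 2 2 2 \<omega> + 4 * Q 1 3 3 \<omega> + Q 0 4 4 \<omega>" for \<omega>
    by (simp add: Q_def power4_eq_xxxx power3_eq_cube power2_eq_square algebra_simps)
  \<comment> \<open>\<open>H 1 = 0\<close> removes the term cubic in \<open>S\<close>, the only one
    that could not be absorbed into the square on the right.\<close>
  have H0: "H 0 = 1" "H 1 = 0" using h0 by (simp_all add: H_def D.prob_space)
  have "(\<integral>\<omega>. (S (Z \<omega>) + h (Y m \<omega>) * T (Z \<omega>)) ^ 4 \<partial>M)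
      = E 4 0 * H 0 + 4 * (E 3 1 * H 1) + 6 * (E 2 2 * H 2) + 4 * (E 1 3 * H 3) + E 0 4 * H 4"
    unfolding e using p by simp
  also have "\<dots> = E 4 0 + 6 * (E 2 2 * H 2) + 4 * (E 1 3 * H 3) + E 0 4 * H 4"
    using H0 by simp
  \<comment> \<open>The coefficients of \<open>u * v\<close> add up to \<open>8 * B\<^sup>2\<close>,
    exactly the cross term of the target square; this is where its constant 4 comes from. The
    \<open>v\<^sup>2\<close> terms add up to \<open>3 * B ^ 4\<close>, below the available
    \<open>16 * B ^ 4\<close>.\<close>
  also have "\<dots> \<le> u\<^sup>2 + 6 * (B\<^sup>2 * (u * v)) + (2 * B\<^sup>2 * (u * v) + 2 * B ^ 4 * v\<^sup>2) + B ^ 4 * v\<^sup>2"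
  proof -
    have E4: "E 4 0 \<le> u\<^sup>2" "E 0 4 \<le> v\<^sup>2" using u v by (simp_all add: E_def)
    have E40: "0 \<le> E 4 0" "0 \<le> E 0 4" "0 \<le> E 2 2" by (simp_all add: E_def)
    have Sm: "(\<lambda>\<omega>. (S (Z \<omega>))\<^sup>2) \<in> borel_measurable M" "(\<lambda>\<omega>. (T (Z \<omega>))\<^sup>2) \<in> borel_measurable M"
      using past_measurable[OF past_power[OF S]] past_measurable[OF past_power[OF T]] m by auto
    have sq: "((x::real)\<^sup>2)\<^sup>2 = x ^ 4" for x by (simp flip: power_mult)
    have "integrable M (\<lambda>\<omega>. ((S (Z \<omega>))\<^sup>2)\<^sup>2)" "integrable M (\<lambda>\<omega>. ((T (Z \<omega>))\<^sup>2)\<^sup>2)"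
      unfolding sq using iST[of 4 0] iST[of 0 4] by simp_all
    from integral_mult_square_le[OF Sm this]
    have "(E 2 2)\<^sup>2 \<le> E 4 0 * E 0 4"
      unfolding sq E_def by (simp only: power_0 mult_1_right mult_1_left)
    also have "\<dots> \<le> u\<^sup>2 * v\<^sup>2" by (intro mult_mono E4 E40) simp
    finally have E22: "E 2 2 \<le> u * v"
      using mult_nonneg_nonneg[OF u(2) v(2)] power2_le_imp_le[of "E 2 2" "u * v"]
      by (simp add: power_mult_distrib)
    \<comment> \<open>The odd mixed moment is reduced to even ones by the arithmetic-geometric mean
      inequality for \<open>\<bar>s\<bar> * \<bar>t\<bar>\<close> and \<open>B * t\<^sup>2\<close>;
      keeping the factor \<open>2 * B\<close> avoids division by \<open>B\<close>, which may be
      0.\<close>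
    have "\<bar>E 1 3\<bar> \<le> (\<integral>\<omega>. \<bar>S (Z \<omega>) ^ 1 * T (Z \<omega>) ^ 3\<bar> \<partial>M)"
      unfolding E_def by (rule integral_abs_bound)
    then have "2 * B * \<bar>E 1 3\<bar> \<le> 2 * B * (\<integral>\<omega>. \<bar>S (Z \<omega>) ^ 1 * T (Z \<omega>) ^ 3\<bar> \<partial>M)"
      using B0 by (intro mult_left_mono) auto
    also have "\<dots> = (\<integral>\<omega>. 2 * B * \<bar>S (Z \<omega>) ^ 1 * T (Z \<omega>) ^ 3\<bar> \<partial>M)"
      by simp
    also have "\<dots> \<le> (\<integral>\<omega>. S (Z \<omega>) ^ 2 * T (Z \<omega>) ^ 2 + B\<^sup>2 * (S (Z \<omega>) ^ 0 * T (Z \<omega>) ^ 4) \<partial>M)"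
    proof (intro integral_mono)
      fix \<omega>
      have "2 * B * (\<bar>s\<bar> * \<bar>t\<bar> ^ 3) \<le> s\<^sup>2 * t\<^sup>2 + B\<^sup>2 * t ^ 4" for s t
        using sum_squares_bound[of "\<bar>s\<bar> * \<bar>t\<bar>" "B * \<bar>t\<bar> ^ 2"]
        by (simp add: power4_eq_xxxx power3_eq_cube power2_eq_square mult_ac)
      then show "2 * B * \<bar>S (Z \<omega>) ^ 1 * T (Z \<omega>) ^ 3\<bar>
          \<le> S (Z \<omega>) ^ 2 * T (Z \<omega>) ^ 2 + B\<^sup>2 * (S (Z \<omega>) ^ 0 * T (Z \<omega>) ^ 4)"
        by (simp add: abs_mult power_abs)
    qed (use iST[of 1 3] iST[of 2 2] iST[of 0 4] in \<open>auto intro!: integrable_abs\<close>)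
    also have "\<dots> = E 2 2 + B\<^sup>2 * E 0 4"
      unfolding E_def using iST[of 2 2] iST[of 0 4] by simp
    also have "\<dots> \<le> u * v + B\<^sup>2 * v\<^sup>2" using E22 E4 by (intro add_mono mult_left_mono) auto
    finally have E13: "2 * B * \<bar>E 1 3\<bar> \<le> u * v + B\<^sup>2 * v\<^sup>2" .
    have "E 1 3 * H 3 \<le> \<bar>E 1 3\<bar> * B ^ 3"
      using Eh[of 3] unfolding H_def[symmetric]
      by - (rule order_trans[OF abs_ge_self], simp add: abs_mult mult_left_mono)
    then have "4 * (E 1 3 * H 3) \<le> 2 * B\<^sup>2 * (2 * B * \<bar>E 1 3\<bar>)"
      by (simp add: power3_eq_cube power2_eq_square mult_ac)
    also have "\<dots> \<le> 2 * B\<^sup>2 * (u * v + B\<^sup>2 * v\<^sup>2)"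
      using E13 by (intro mult_left_mono) auto
    finally have t3: "4 * (E 1 3 * H 3) \<le> 2 * B\<^sup>2 * (u * v) + 2 * B ^ 4 * v\<^sup>2"
      by (simp add: power4_eq_xxxx power2_eq_square algebra_simps)
    have "E 2 2 * H 2 \<le> (u * v) * B\<^sup>2"
      using Eh[of 2] by (intro mult_mono' E22 E40) (auto simp: H_def)
    moreover have "E 0 4 * H 4 \<le> v\<^sup>2 * B ^ 4"
      using Eh[of 4] by (intro mult_mono' E4 E40) (auto simp: H_def)
    ultimately show ?thesis using t3 E4 by (simp add: mult.commute)
  qed
  also have "\<dots> \<le> (u + 4 * B\<^sup>2 * v)\<^sup>2"
  proof -
    have "0 \<le> B ^ 4 * v\<^sup>2" by simp
    then show ?thesis by (simp add: power4_eq_xxxx power2_eq_square algebra_simps)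
  qed
  finally show ?thesis .
qed

text \<open>Recursion with the constant \<open>T = c m\<close>, whose fourth moment is the square of
  \<open>v = (c m)\<^sup>2\<close>.\<close>

lemma lin_fourth_moment:
  assumes h: "h \<in> borel_measurable borel" and B: "\<And>x. \<bar>h x\<bar> \<le> B" and h0: "(\<integral>x. h x \<partial>D) = 0"
  shows "m \<le> n \<Longrightarrow> (\<integral>\<omega>. (lin c h m (Z \<omega>)) ^ 4 \<partial>M) \<le> (4 * B\<^sup>2 * (\<Sum>i<m. (c i)\<^sup>2))\<^sup>2"
proof (induction m)
  case 0
  show ?case by (simp add: lin_def)
next
  case (Suc m)
  have e: "lin c h (Suc m) z = lin c h m z + h (z m) * c m" for z by (simp add: lin_def)
  have "(\<integral>\<omega>. (lin c h m (Z \<omega>) + h (Y m \<omega>) * c m) ^ 4 \<partial>M)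
      \<le> (4 * B\<^sup>2 * (\<Sum>i<m. (c i)\<^sup>2) + 4 * B\<^sup>2 * (c m)\<^sup>2)\<^sup>2"
    using Suc h h0
    by (intro fourth_moment_step past_lin past_const lin_bounded[OF B] B)
      (auto simp: prob_space sum_nonneg simp flip: power_mult)
  then show ?case unfolding e by (simp add: distrib_left)
qed

text \<open>Recursion with \<open>T = lin (c m) h m\<close>. The bound for \<open>lin\<close>
  supplies \<open>v\<close> with a factor \<open>4 * B\<^sup>2\<close>, and the step contributes
  another one, whence \<open>16 * B ^ 4\<close>.\<close>

lemma quad_fourth_moment:
  assumes h: "h \<in> borel_measurable borel" and B: "\<And>x. \<bar>h x\<bar> \<le> B" and h0: "(\<integral>x. h x \<partial>D) = 0"
  shows "m \<le> n \<Longrightarrow>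
    (\<integral>\<omega>. (quad c h h m (Z \<omega>)) ^ 4 \<partial>M) \<le> (16 * B ^ 4 * (\<Sum>j<m. \<Sum>i<j. (c j i)\<^sup>2))\<^sup>2"
proof (induction m)
  case 0
  show ?case by (simp add: quad_def)
next
  case (Suc m)
  have e: "quad c h h (Suc m) z = quad c h h m z + h (z m) * lin (c m) h m z" for z
    by (simp add: quad_def)
  have "(\<integral>\<omega>. (quad c h h m (Z \<omega>) + h (Y m \<omega>) * lin (c m) h m (Z \<omega>)) ^ 4 \<partial>M)
      \<le> (16 * B ^ 4 * (\<Sum>j<m. \<Sum>i<j. (c j i)\<^sup>2) + 4 * B\<^sup>2 * (4 * B\<^sup>2 * (\<Sum>i<m. (c m i)\<^sup>2)))\<^sup>2"
    using Suc h h0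
    by (intro fourth_moment_step past_lin past_quad lin_bounded[OF B] quad_bounded[OF B B] B
        lin_fourth_moment[OF h B h0])
      (auto simp: sum_nonneg)
  then show ?case unfolding e by (simp add: distrib_left power4_eq_xxxx power2_eq_square mult_ac)
qed

end

subsection \<open>Truncation\<close>

lemma (in prob_space) prob_abs_ge_le:
  assumes [measurable]: "random_variable borel U"
    and i: "integrable M (\<lambda>\<omega>. \<bar>U \<omega>\<bar> ^ k)"
    and b: "expectation (\<lambda>\<omega>. \<bar>U \<omega>\<bar> ^ k) \<le> b" and s: "0 < s"
  shows "prob {\<omega> \<in> space M. s \<le> \<bar>U \<omega>\<bar>} \<le> b / s ^ k"
proof -
  have "prob {\<omega> \<in> space M. s \<le> \<bar>U \<omega>\<bar>} \<le> prob {\<omega> \<in> space M. s ^ k \<le> \<bar>U \<omega>\<bar> ^ k}"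
    using s by (intro finite_measure_mono) (auto intro: power_mono)
  also have "\<dots> \<le> expectation (\<lambda>\<omega>. \<bar>U \<omega>\<bar> ^ k) / s ^ k"
    using s by (intro integral_Markov_inequality_measure[OF i, of "{}"]) auto
  also have "\<dots> \<le> b / s ^ k" using b s by (intro divide_right_mono) auto
  finally show ?thesis .
qed

lemma (in prob_space) prob_abs_add_ge_le:
  fixes U V :: "'a \<Rightarrow> real"
  assumes [measurable]: "random_variable borel U" "random_variable borel V"
  shows "prob {\<omega> \<in> space M. t \<le> \<bar>U \<omega> + V \<omega>\<bar>}
    \<le> prob {\<omega> \<in> space M. t / 2 \<le> \<bar>U \<omega>\<bar>} + prob {\<omega> \<in> space M. t / 2 \<le> \<bar>V \<omega>\<bar>}"
proof -
  have "prob {\<omega> \<in> space M. t \<le> \<bar>U \<omega> + V \<omega>\<bar>}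
      \<le> prob ({\<omega> \<in> space M. t / 2 \<le> \<bar>U \<omega>\<bar>} \<union> {\<omega> \<in> space M. t / 2 \<le> \<bar>V \<omega>\<bar>})"
    by (intro finite_measure_mono) auto
  also have "\<dots> \<le> prob {\<omega> \<in> space M. t / 2 \<le> \<bar>U \<omega>\<bar>} + prob {\<omega> \<in> space M. t / 2 \<le> \<bar>V \<omega>\<bar>}"
    by (intro measure_Un_le) auto
  finally show ?thesis .
qed

definition tail :: "real measure \<Rightarrow> (real \<Rightarrow> real) \<Rightarrow> nat \<Rightarrow> real \<Rightarrow> real" where
  "tail D h k B = (\<integral>x. \<bar>h x\<bar> ^ k * indicator {x. B < \<bar>h x\<bar>} x \<partial>D)"

text \<open>\<open>trunc\<close> is recentred, so that both \<open>trunc\<close> and \<open>rest\<close> have mean zero when \<open>h\<close> has.\<close>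

definition trunc :: "real measure \<Rightarrow> (real \<Rightarrow> real) \<Rightarrow> real \<Rightarrow> real \<Rightarrow> real" where
  "trunc D h B x = h x * indicator {x. \<bar>h x\<bar> \<le> B} x - (\<integral>y. h y * indicator {x. \<bar>h x\<bar> \<le> B} y \<partial>D)"

definition rest :: "real measure \<Rightarrow> (real \<Rightarrow> real) \<Rightarrow> real \<Rightarrow> real \<Rightarrow> real" where
  "rest D h B x = h x - trunc D h B x"

lemma tail_nonneg: "0 \<le> tail D h k B"
  by (simp add: tail_def)

text \<open>Dominated convergence: at each point the integrand is 0 as soon as \<open>B\<close>
  reaches \<open>\<bar>h x\<bar>\<close>.\<close>

lemma tail_tendsto_0:
  assumes [measurable]: "h \<in> borel_measurable D" and i: "integrable D (\<lambda>x. \<bar>h x\<bar> ^ k)"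
  shows "(tail D h k \<longlongrightarrow> 0) at_top"
proof -
  have "((\<lambda>B. \<integral>x. \<bar>h x\<bar> ^ k * indicator {x. B < \<bar>h x\<bar>} x \<partial>D) \<longlongrightarrow> (\<integral>x. 0 \<partial>D)) at_top"
  proof (rule integral_dominated_convergence_at_top[where w = "\<lambda>x. \<bar>h x\<bar> ^ k"])
    show "AE x in D. ((\<lambda>B. \<bar>h x\<bar> ^ k * indicator {x. B < \<bar>h x\<bar>} x) \<longlongrightarrow> 0) at_top"
    proof (rule AE_I2, rule tendsto_eventually)
      fix x
      show "\<forall>\<^sub>F B in at_top. \<bar>h x\<bar> ^ k * indicator {x. B < \<bar>h x\<bar>} x = 0"
        using eventually_ge_at_top[of "\<bar>h x\<bar>"] by eventually_elim simp
    qed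
  qed (use i in \<open>auto simp: indicator_def\<close>)
  then show ?thesis by (simp add: tail_def[abs_def])
qed

locale centred_function = D: prob_space D for D :: "real measure" +
  fixes h :: "real \<Rightarrow> real" and B :: real
  assumes sets_D [measurable_cong]: "sets D = sets borel"
    and h [measurable]: "h \<in> borel_measurable borel"
    and h1: "integrable D h" and h0: "(\<integral>x. h x \<partial>D) = 0"
    and B: "0 \<le> B"
begin

lemma trunc_measurable [measurable]: "trunc D h B \<in> borel_measurable borel"
  unfolding trunc_def[abs_def] by measurable

lemma rest_measurable [measurable]: "rest D h B \<in> borel_measurable borel"
  unfolding rest_def[abs_def] by measurable

lemma integrable_part [simp]: "integrable D (\<lambda>x. h x * indicator {x. \<bar>h x\<bar> \<le> B} x)"
  "integrable D (\<lambda>x. h x * indicator {x. B < \<bar>h x\<bar>} x)"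
  using h1 by (auto intro!: Bochner_Integration.integrable_bound[OF h1] simp: indicator_def)

text \<open>One \<open>B\<close> bounds the truncated value, the other the mean subtracted by the
  recentring.\<close>

lemma trunc_bound: "\<bar>trunc D h B x\<bar> \<le> 2 * B"
proof -
  have "\<bar>\<integral>y. h y * indicator {x. \<bar>h x\<bar> \<le> B} y \<partial>D\<bar> \<le> (\<integral>y. \<bar>h y * indicator {x. \<bar>h x\<bar> \<le> B} y\<bar> \<partial>D)"
    by (rule integral_abs_bound)
  also have "\<dots> \<le> (\<integral>y. B \<partial>D)"
    using B by (intro integral_mono integrable_abs integrable_part) (auto simp: indicator_def)
  finally have "\<bar>\<integral>y. h y * indicator {x. \<bar>h x\<bar> \<le> B} y \<partial>D\<bar> \<le> B" by (simp add: D.prob_space)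
  moreover have "\<bar>h x * indicator {x. \<bar>h x\<bar> \<le> B} x\<bar> \<le> B" using B by (auto simp: indicator_def)
  ultimately show ?thesis unfolding trunc_def by linarith
qed

lemma trunc_centred: "(\<integral>x. trunc D h B x \<partial>D) = 0"
  unfolding trunc_def by (simp add: D.prob_space)

lemma integrable_trunc [simp]: "integrable D (trunc D h B)"
  unfolding trunc_def[abs_def] by simp

lemma integrable_rest [simp]: "integrable D (rest D h B)"
  unfolding rest_def[abs_def] using h1 by simp

lemma rest_centred: "(\<integral>x. rest D h B x \<partial>D) = 0"
  unfolding rest_def using h1 h0 trunc_centred by simp

text \<open>Since \<open>h\<close> has mean 0, the means of its small and large parts are opposite.
  Thus \<open>rest\<close> is the recentred large part, which is why \<open>tail\<close> controls
  its moments.\<close>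

lemma rest_eq:
  "rest D h B x = h x * indicator {x. B < \<bar>h x\<bar>} x - (\<integral>y. h y * indicator {x. B < \<bar>h x\<bar>} y \<partial>D)"
proof -
  have e: "h y = h y * indicator {x. \<bar>h x\<bar> \<le> B} y + h y * indicator {x. B < \<bar>h x\<bar>} y" for y
    by (simp add: indicator_def)
  have "0 = (\<integral>y. h y * indicator {x. \<bar>h x\<bar> \<le> B} y + h y * indicator {x. B < \<bar>h x\<bar>} y \<partial>D)"
    using h0 e by simp
  also have "\<dots> = (\<integral>y. h y * indicator {x. \<bar>h x\<bar> \<le> B} y \<partial>D) + (\<integral>y. h y * indicator {x. B < \<bar>h x\<bar>} y \<partial>D)"
    by simp
  finally show ?thesis unfolding rest_def trunc_def using e[of x] by linarith
qed

lemma rest_first_moment: "(\<integral>x. \<bar>rest D h B x\<bar> \<partial>D) \<le> 2 * tail D h 1 B"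
proof -
  let ?w = "\<lambda>x. h x * indicator {x. B < \<bar>h x\<bar>} x"
  have w: "(\<integral>x. \<bar>?w x\<bar> \<partial>D) = tail D h 1 B" by (simp add: tail_def abs_mult)
  have "(\<integral>x. \<bar>rest D h B x\<bar> \<partial>D) \<le> (\<integral>x. \<bar>?w x\<bar> + \<bar>\<integral>y. ?w y \<partial>D\<bar> \<partial>D)"
    unfolding rest_eq by (intro integral_mono) auto
  also have "\<dots> = (\<integral>x. \<bar>?w x\<bar> \<partial>D) + \<bar>\<integral>y. ?w y \<partial>D\<bar>"
    using integrable_abs[OF integrable_part(2)] by (simp add: D.prob_space del: integrable_abs_iff)
  also have "\<dots> \<le> 2 * tail D h 1 B"
    using integral_abs_bound[of D ?w] w by simp
  finally show ?thesis .
qed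

text \<open>A variance is at most the second moment, so recentring costs no factor in mean square,
  whereas in the first moment it costs a factor 2.\<close>

lemma centred_second_moment:
  assumes "integrable D w" "integrable D (\<lambda>x. (w x)\<^sup>2 :: real)"
  shows "integrable D (\<lambda>x. (w x - (\<integral>y. w y \<partial>D))\<^sup>2)"
    and "(\<integral>x. (w x - (\<integral>y. w y \<partial>D))\<^sup>2 \<partial>D) \<le> (\<integral>x. (w x)\<^sup>2 \<partial>D)"
  using assms D.variance_eq[OF assms] by (auto simp: power2_diff)

context
  assumes h2: "integrable D (\<lambda>x. (h x)\<^sup>2)"
begin

lemma integrable_part_square [simp]: "integrable D (\<lambda>x. (h x * indicator {x. \<bar>h x\<bar> \<le> B} x)\<^sup>2)"
  "integrable D (\<lambda>x. (h x * indicator {x. B < \<bar>h x\<bar>} x)\<^sup>2)"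
  by (rule Bochner_Integration.integrable_bound[OF h2]; auto simp: indicator_def)+

lemma integrable_trunc_square: "integrable D (\<lambda>x. (trunc D h B x)\<^sup>2)"
  unfolding trunc_def by (intro centred_second_moment) auto

lemma integrable_rest_square: "integrable D (\<lambda>x. (rest D h B x)\<^sup>2)"
  unfolding rest_eq by (intro centred_second_moment) auto

lemma trunc_second_moment: "(\<integral>x. (trunc D h B x)\<^sup>2 \<partial>D) \<le> (\<integral>x. (h x)\<^sup>2 \<partial>D)"
proof -
  have "(\<integral>x. (trunc D h B x)\<^sup>2 \<partial>D) \<le> (\<integral>x. (h x * indicator {x. \<bar>h x\<bar> \<le> B} x)\<^sup>2 \<partial>D)"
    unfolding trunc_def by (intro centred_second_moment) auto
  also have "\<dots> \<le> (\<integral>x. (h x)\<^sup>2 \<partial>D)"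
    by (intro integral_mono integrable_part_square(1) h2) (auto simp: indicator_def)
  finally show ?thesis .
qed

lemma rest_second_moment: "(\<integral>x. (rest D h B x)\<^sup>2 \<partial>D) \<le> tail D h 2 B"
proof -
  have "(\<integral>x. (rest D h B x)\<^sup>2 \<partial>D) \<le> (\<integral>x. (h x * indicator {x. B < \<bar>h x\<bar>} x)\<^sup>2 \<partial>D)"
    unfolding rest_eq by (intro centred_second_moment) auto
  also have "\<dots> = tail D h 2 B"
    unfolding tail_def by (intro Bochner_Integration.integral_cong) (auto simp: indicator_def)
  finally show ?thesis .
qed

end

end

subsection \<open>Concentration\<close>

lemma lin_add: "lin c (\<lambda>x. h x + k x) m z = lin c h m z + lin c k m z"
  by (simp add: lin_def sum.distrib distrib_left)

lemma quad_add_right: "quad c h (\<lambda>x. k x + l x) m z = quad c h k m z + quad c h l m z"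
  by (simp add: quad_def sum.distrib distrib_right)

lemma quad_add_left: "quad c (\<lambda>x. h x + l x) k m z = quad c h k m z + quad c l k m z"
  by (simp add: quad_def lin_add sum.distrib distrib_left)

lemma lin_trunc_rest: "lin c h m z = lin c (trunc D h B) m z + lin c (rest D h B) m z"
  using lin_add[of c "trunc D h B" "rest D h B"] by (simp add: rest_def)

text \<open>The right factor is split first, then the left one next to the truncated right factor.
  Only two remainder forms arise, each with one small factor \<open>rest\<close>.\<close>

lemma quad_trunc_rest:
  "quad c h h m z = quad c (trunc D h B) (trunc D h B) m z
    + (quad c h (rest D h B) m z + quad c (rest D h B) (trunc D h B) m z)"
  using quad_add_right[of c h "trunc D h B" "rest D h B" m z]
    quad_add_left[of c "trunc D h B" "rest D h B" "trunc D h B" m z] by (simp add: rest_def)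

text \<open>Passing from \<open>n\<close> to \<open>n + 1\<close> adds a row and a column that agree
  by symmetry; together they are twice the new increment of \<open>quad\<close>.\<close>

lemma symmetric_form_eq:
  assumes "\<And>i j. i < n \<Longrightarrow> j < n \<Longrightarrow> p i j = p j i"
  shows "(\<Sum>i<n. \<Sum>j<n. p i j * (z i * z j))
    = (\<Sum>i<n. p i i * (z i)\<^sup>2) + 2 * quad p (\<lambda>x. x) (\<lambda>x. x) n z"
  using assms
proof (induction n)
  case 0
  show ?case by (simp add: quad_def)
next
  case (Suc n)
  have "(\<Sum>i<n. p i n * (z i * z n)) = z n * (\<Sum>i<n. p n i * z i)"
    "(\<Sum>i<n. p n i * (z n * z i)) = z n * (\<Sum>i<n. p n i * z i)"
    using Suc.prems by (auto simp: sum_distrib_left mult_ac intro!: sum.cong)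
  then show ?case using Suc
    by (simp add: quad_def lin_def sum.distrib power2_eq_square)
qed

context iid_sample
begin

lemma centred_functionI:
  assumes "h \<in> borel_measurable borel" "integrable D h" "(\<integral>x. h x \<partial>D) = 0" "0 \<le> B"
  shows "centred_function D h B"
  using assms sets_D by unfold_locales auto

lemma integrable_of_square:
  fixes h :: "real \<Rightarrow> real"
  assumes "h \<in> borel_measurable borel" "integrable D (\<lambda>x. (h x)\<^sup>2)"
  shows "integrable D h"
  using D.square_integrable_imp_integrable[of h] assms by simp

text \<open>The bound involves neither \<open>n\<close> nor \<open>c\<close>, hence is uniform over
  dimensions and unit vectors. The bounded part is controlled by its fourth moment, which costs a
  factor \<open>1 / K\<close>, the remainder by its variance.\<close>

lemma lin_uniform_integrability:
  assumes h: "h \<in> borel_measurable borel" and h2: "integrable D (\<lambda>x. (h x)\<^sup>2)"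
    and h0: "(\<integral>x. h x \<partial>D) = 0"
    and c: "(\<Sum>i<n. (c i)\<^sup>2) = 1" and B: "0 \<le> B" and K: "0 < K"
  shows "(\<integral>\<^sup>+\<omega>. ennreal ((lin c h n (Z \<omega>))\<^sup>2 * indicator {\<omega>. K \<le> (lin c h n (Z \<omega>))\<^sup>2} \<omega>) \<partial>M)
    \<le> ennreal (4096 * B ^ 4 / K + 4 * tail D h 2 B)"
proof -
  interpret C: centred_function D h B
    by (rule centred_functionI[OF h integrable_of_square[OF h h2] h0 B])
  define U where "U \<omega> = lin c (trunc D h B) n (Z \<omega>)" for \<omega>
  define V where "V \<omega> = lin c (rest D h B) n (Z \<omega>)" for \<omega>
  have UV: "lin c h n (Z \<omega>) = U \<omega> + V \<omega>" for \<omega>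
    unfolding U_def V_def by (rule lin_trunc_rest)
  have pU: "past n (lin c (trunc D h B) n)" by (intro past_lin) auto
  have iU: "integrable M (\<lambda>\<omega>. U \<omega> ^ 4)"
    unfolding U_def by (intro past_integrable_power[OF pU] lin_bounded[OF C.trunc_bound] order_refl)
  \<comment> \<open>With bound \<open>2 * B\<close> and unit coefficients, the constant is
    \<open>(4 * (2 * B)\<^sup>2)\<^sup>2\<close>.\<close>
  have U4: "(\<integral>\<omega>. U \<omega> ^ 4 \<partial>M) \<le> 256 * B ^ 4"
    using lin_fourth_moment[of "trunc D h B" "2 * B" n c] C.trunc_bound C.trunc_centred c
    by (simp add: U_def power_mult_distrib flip: power_mult)
  have iV: "integrable M (\<lambda>\<omega>. (V \<omega>)\<^sup>2)"
    unfolding V_def by (intro lin_second_moment C.integrable_rest_square C.rest_centred h2) auto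
  have V2: "(\<integral>\<omega>. (V \<omega>)\<^sup>2 \<partial>M) \<le> tail D h 2 B"
    using lin_second_moment(2)[of "rest D h B" n c] C.integrable_rest_square[OF h2] C.rest_centred c
      C.rest_second_moment[OF h2] by (simp add: V_def)
  have "(lin c h n (Z \<omega>))\<^sup>2 * indicator {\<omega>. K \<le> (lin c h n (Z \<omega>))\<^sup>2} \<omega>
      \<le> 16 * U \<omega> ^ 4 / K + 4 * (V \<omega>)\<^sup>2" (is "?l \<le> ?r") for \<omega>
  \<comment> \<open>The larger of the two parts decides. If it is \<open>U\<close>, the square
    \<open>q\<close> of the sum is at most \<open>4 * (U \<omega>)\<^sup>2\<close>, and
    \<open>K \<le> q\<close> gives \<open>K * q \<le> q\<^sup>2\<close>. Otherwise \<open>q\<close>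
    is at most \<open>4 * (V \<omega>)\<^sup>2\<close>.\<close>
  proof (cases "K \<le> (U \<omega> + V \<omega>)\<^sup>2 \<and> \<bar>V \<omega>\<bar> \<le> \<bar>U \<omega>\<bar>")
    case True
    have "(U \<omega> + V \<omega>)\<^sup>2 \<le> (2 * U \<omega>)\<^sup>2"
      using True by (subst abs_le_square_iff[symmetric]) linarith
    then have 1: "(U \<omega> + V \<omega>)\<^sup>2 \<le> 4 * (U \<omega>)\<^sup>2" by (simp add: power_mult_distrib)
    then have "K * (U \<omega> + V \<omega>)\<^sup>2 \<le> (4 * (U \<omega>)\<^sup>2) * (4 * (U \<omega>)\<^sup>2)"
      using True K by (intro mult_mono) auto
    then have "(U \<omega> + V \<omega>)\<^sup>2 \<le> 16 * U \<omega> ^ 4 / K"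
      using K by (simp add: field_simps power4_eq_xxxx power2_eq_square)
    then show ?thesis using True UV by (simp add: add_increasing2)
  next
    case False
    have r: "0 \<le> 16 * U \<omega> ^ 4 / K" using K by simp
    show ?thesis
    proof (cases "K \<le> (U \<omega> + V \<omega>)\<^sup>2")
      case True
      then have "(U \<omega> + V \<omega>)\<^sup>2 \<le> (2 * V \<omega>)\<^sup>2"
        using False by (subst abs_le_square_iff[symmetric]) linarith
      then show ?thesis using True UV r by (simp add: power_mult_distrib)
    next
      case False
      then show ?thesis using UV r by simp
    qed
  qed
  then have "(\<integral>\<^sup>+\<omega>. ennreal ((lin c h n (Z \<omega>))\<^sup>2 * indicator {\<omega>. K \<le> (lin c h n (Z \<omega>))\<^sup>2} \<omega>) \<partial>M)
      \<le> (\<integral>\<^sup>+\<omega>. ennreal (16 * U \<omega> ^ 4 / K + 4 * (V \<omega>)\<^sup>2) \<partial>M)"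
    by (intro nn_integral_mono ennreal_leI)
  also have "\<dots> = ennreal (\<integral>\<omega>. 16 * U \<omega> ^ 4 / K + 4 * (V \<omega>)\<^sup>2 \<partial>M)"
    using iU iV K by (intro nn_integral_eq_integral) auto
  also have "(\<integral>\<omega>. 16 * U \<omega> ^ 4 / K + 4 * (V \<omega>)\<^sup>2 \<partial>M) = 16 * (\<integral>\<omega>. U \<omega> ^ 4 \<partial>M) / K + 4 * (\<integral>\<omega>. (V \<omega>)\<^sup>2 \<partial>M)"
    using iU iV by simp
  also have "ennreal \<dots> \<le> ennreal (4096 * B ^ 4 / K + 4 * tail D h 2 B)"
    using U4 V2 K by (intro ennreal_leI add_mono) (auto simp: divide_right_mono)
  finally show ?thesis .
qed

end

text \<open>The matrix \<open>p\<close> abstracts a projection of rank \<open>r\<close>, which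
  enters the tail bounds through its nonnegative diagonal, its trace and two sums of
  squares.\<close>

locale quadratic_form = iid_sample M n Y D
  for M :: "'a measure" and n Y D +
  fixes p :: "nat \<Rightarrow> nat \<Rightarrow> real" and r :: real
  assumes second_moment: "integrable D (\<lambda>x. x\<^sup>2)" and mean: "(\<integral>x. x \<partial>D) = 0"
    and variance: "(\<integral>x. x\<^sup>2 \<partial>D) = 1"
    and diag: "\<And>i. i < n \<Longrightarrow> 0 \<le> p i i" "(\<Sum>i<n. p i i) = r" "(\<Sum>i<n. (p i i)\<^sup>2) \<le> r"
    and off_diag: "(\<Sum>j<n. \<Sum>i<j. (p j i)\<^sup>2) \<le> r"
    and r: "1 \<le> r"
begin

abbreviation dev :: "'a \<Rightarrow> real" where
  "dev \<omega> \<equiv> lin (\<lambda>i. p i i) (\<lambda>x. x\<^sup>2 - 1) n (Z \<omega>) + 2 * quad p (\<lambda>x. x) (\<lambda>x. x) n (Z \<omega>)"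

lemma centred_id: "0 \<le> B \<Longrightarrow> centred_function D (\<lambda>x. x) B"
  using mean second_moment by (intro centred_functionI) (auto intro: integrable_of_square)

lemma centred_square: "0 \<le> B \<Longrightarrow> centred_function D (\<lambda>x. x\<^sup>2 - 1) B"
  using variance second_moment by (intro centred_functionI) (auto simp: D.prob_space)

lemma lin_measurable [measurable]:
  "h \<in> borel_measurable borel \<Longrightarrow> (\<lambda>\<omega>. lin c h n (Z \<omega>)) \<in> borel_measurable M"
  by (intro past_measurable[of n] past_lin) auto

lemma quad_measurable [measurable]:
  "h \<in> borel_measurable borel \<Longrightarrow> k \<in> borel_measurable borel \<Longrightarrow>
    (\<lambda>\<omega>. quad c h k n (Z \<omega>)) \<in> borel_measurable M"
  by (intro past_measurable[of n] past_quad) auto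

text \<open>Without a fourth moment \<open>x\<^sup>2 - 1\<close> need not be square integrable, so
  its remainder is treated in first moment, using that the diagonal sums to \<open>r\<close>.
  Chebyshev's inequality handles the truncated diagonal, and also the off-diagonal form, which
  multiplies distinct coordinates and needs second moments only.\<close>

lemma deviation_second_moment:
  assumes B: "0 \<le> B" and s: "0 < s"
  shows "prob {\<omega> \<in> space M. s * r \<le> \<bar>dev \<omega>\<bar>}
    \<le> 36 * (B\<^sup>2 + 1) / (s\<^sup>2 * r) + 6 * tail D (\<lambda>x. x\<^sup>2 - 1) 1 B / s"
proof -
  let ?h = "\<lambda>x::real. x\<^sup>2 - 1"
  interpret C: centred_function D ?h B by (rule centred_square[OF B])
  define U where "U \<omega> = lin (\<lambda>i. p i i) (trunc D ?h B) n (Z \<omega>)" for \<omega>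
  define V where "V \<omega> = lin (\<lambda>i. p i i) (rest D ?h B) n (Z \<omega>)" for \<omega>
  define W where "W \<omega> = 2 * quad p (\<lambda>x. x) (\<lambda>x. x) n (Z \<omega>)" for \<omega>
  have [measurable]: "U \<in> borel_measurable M" "V \<in> borel_measurable M" "W \<in> borel_measurable M"
    unfolding U_def[abs_def] V_def[abs_def] W_def[abs_def] by measurable
  have dev: "dev \<omega> = U \<omega> + V \<omega> + W \<omega>" for \<omega>
    unfolding U_def V_def W_def lin_trunc_rest[of _ ?h _ _ D B] ..
  \<comment> \<open>A third of the threshold for each of \<open>U\<close>, \<open>V\<close> and
    \<open>W\<close>.\<close>
  let ?s = "s * r / 3"
  have s3: "0 < ?s" using s r by simp
  have tb: "(trunc D ?h B x)\<^sup>2 \<le> 4 * B\<^sup>2" for x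
    using power_mono[OF C.trunc_bound[of x], of 2] by (simp add: power_mult_distrib)
  have t2: "integrable D (\<lambda>x. (trunc D ?h B x)\<^sup>2)"
    by (rule D.integrable_const_bound[of _ "4 * B\<^sup>2"]) (use tb in auto)
  note mU = lin_second_moment[OF C.trunc_measurable t2 C.trunc_centred order_refl, of "\<lambda>i. p i i"]
  have "(\<integral>x. (trunc D ?h B x)\<^sup>2 \<partial>D) \<le> (\<integral>x. 4 * B\<^sup>2 \<partial>D)"
    using t2 tb by (intro integral_mono) auto
  then have "(\<integral>\<omega>. (U \<omega>)\<^sup>2 \<partial>M) \<le> 4 * B\<^sup>2 * r"
    unfolding U_def mU(2) by (intro mult_mono diag(3)) (auto simp: D.prob_space sum_nonneg)
  then have pU: "prob {\<omega> \<in> space M. ?s \<le> \<bar>U \<omega>\<bar>} \<le> 4 * B\<^sup>2 * r / ?s\<^sup>2"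
    using mU(1) by (intro prob_abs_ge_le s3) (simp_all add: U_def)
  note mV = lin_first_moment[OF C.rest_measurable C.integrable_rest order_refl, of "\<lambda>i. p i i"]
  have "(\<Sum>i<n. \<bar>p i i\<bar>) = r" using diag(1,2) by simp
  then have "(\<integral>\<omega>. \<bar>V \<omega>\<bar> \<partial>M) \<le> 2 * tail D ?h 1 B * r"
    using order_trans[OF mV(2) mult_right_mono[OF C.rest_first_moment]] r by (simp add: V_def)
  then have pV: "prob {\<omega> \<in> space M. ?s \<le> \<bar>V \<omega>\<bar>} \<le> 2 * tail D ?h 1 B * r / ?s"
    using mV(1) prob_abs_ge_le[of V 1 "2 * tail D ?h 1 B * r" ?s] s3 by (simp add: V_def)
  have id: "(\<lambda>x::real. x) \<in> borel_measurable borel" by simp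
  note mW = quad_second_moment[OF id second_moment mean id second_moment mean order_refl, of p]
  have "(\<integral>\<omega>. (W \<omega>)\<^sup>2 \<partial>M) \<le> 4 * r"
    using mW off_diag variance by (simp add: W_def power_mult_distrib)
  then have pW: "prob {\<omega> \<in> space M. ?s \<le> \<bar>W \<omega>\<bar>} \<le> 4 * r / ?s\<^sup>2"
    using mW(1) by (intro prob_abs_ge_le s3) (simp_all add: W_def power_mult_distrib)
  have "prob {\<omega> \<in> space M. s * r \<le> \<bar>dev \<omega>\<bar>}
      \<le> prob ({\<omega> \<in> space M. ?s \<le> \<bar>U \<omega>\<bar>} \<union> {\<omega> \<in> space M. ?s \<le> \<bar>V \<omega>\<bar>} \<union> {\<omega> \<in> space M. ?s \<le> \<bar>W \<omega>\<bar>})"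
    unfolding dev by (intro finite_measure_mono) auto
  also have "\<dots> \<le> prob {\<omega> \<in> space M. ?s \<le> \<bar>U \<omega>\<bar>} + prob {\<omega> \<in> space M. ?s \<le> \<bar>V \<omega>\<bar>}
      + prob {\<omega> \<in> space M. ?s \<le> \<bar>W \<omega>\<bar>}"
    by (intro order_trans[OF measure_Un_le] add_right_mono measure_Un_le) auto
  also have "\<dots> \<le> 4 * B\<^sup>2 * r / ?s\<^sup>2 + 2 * tail D ?h 1 B * r / ?s + 4 * r / ?s\<^sup>2"
    by (intro add_mono pU pV pW)
  also have "\<dots> = 36 * (B\<^sup>2 + 1) / (s\<^sup>2 * r) + 6 * tail D ?h 1 B / s"
    using s r by (simp add: field_simps power2_eq_square)
  finally show ?thesis .
qed

text \<open>
  Markov's inequality is applied with the fourth moment to the truncated part and with the second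
  moment to the remainder, whose variance is small relative to \<open>r\<close>.
\<close>

lemma deviation_fourth_moment:
  assumes i4: "integrable D (\<lambda>x. x ^ 4)" and B: "1 \<le> B" and t: "0 < t"
  shows "prob {\<omega> \<in> space M. t \<le> \<bar>dev \<omega>\<bar>}
    \<le> 2 ^ 28 * B ^ 8 * r\<^sup>2 / t ^ 4
      + (12 * tail D (\<lambda>x. x\<^sup>2 - 1) 2 B + 96 * tail D (\<lambda>x. x) 2 B) * r / t\<^sup>2"
proof -
  let ?h = "\<lambda>x::real. x\<^sup>2 - 1" and ?c = "\<lambda>i. p i i"
  let ?a = "trunc D (\<lambda>x. x) B" and ?b = "rest D (\<lambda>x. x) B"
  have B0: "0 \<le> B" using B by simp
  interpret C: centred_function D ?h B by (rule centred_square[OF B0])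
  interpret I: centred_function D "\<lambda>x. x" B by (rule centred_id[OF B0])
  have h2: "integrable D (\<lambda>x. (?h x)\<^sup>2)"
    using i4 second_moment by (auto simp: power2_diff simp flip: power_mult)
  define U1 where "U1 \<omega> = lin ?c (trunc D ?h B) n (Z \<omega>)" for \<omega>
  define U2 where "U2 \<omega> = 2 * quad p ?a ?a n (Z \<omega>)" for \<omega>
  define V1 where "V1 \<omega> = lin ?c (rest D ?h B) n (Z \<omega>)" for \<omega>
  define V2 where "V2 \<omega> = 2 * quad p (\<lambda>x. x) ?b n (Z \<omega>)" for \<omega>
  define V3 where "V3 \<omega> = 2 * quad p ?b ?a n (Z \<omega>)" for \<omega>
  define U where "U \<omega> = U1 \<omega> + U2 \<omega>" for \<omega>
  define V where "V \<omega> = V1 \<omega> + V2 \<omega> + V3 \<omega>" for \<omega>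
  have dev: "dev \<omega> = U \<omega> + V \<omega>" for \<omega>
    unfolding U_def V_def U1_def U2_def V1_def V2_def V3_def
      lin_trunc_rest[of _ ?h _ _ D B] quad_trunc_rest[of p "\<lambda>x. x" n _ D B] by simp
  have id: "(\<lambda>x::real. x) \<in> borel_measurable borel" by simp
  have m1: "U1 \<in> borel_measurable M" unfolding U1_def[abs_def]
    by (rule lin_measurable[OF C.trunc_measurable])
  have m2: "U2 \<in> borel_measurable M" unfolding U2_def[abs_def]
    by (rule borel_measurable_times[OF borel_measurable_const
          quad_measurable[OF I.trunc_measurable I.trunc_measurable]])
  have m3: "V1 \<in> borel_measurable M" unfolding V1_def[abs_def]
    by (rule lin_measurable[OF C.rest_measurable])
  have m4: "V2 \<in> borel_measurable M" unfolding V2_def[abs_def]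
    by (rule borel_measurable_times[OF borel_measurable_const quad_measurable[OF id I.rest_measurable]])
  have m5: "V3 \<in> borel_measurable M" unfolding V3_def[abs_def]
    by (rule borel_measurable_times[OF borel_measurable_const
          quad_measurable[OF I.rest_measurable I.trunc_measurable]])
  note [measurable] = m1 m2 m3 m4 m5
  have mU [measurable]: "U \<in> borel_measurable M"
    unfolding U_def[abs_def] by (rule borel_measurable_add[OF m1 m2])
  have mV [measurable]: "V \<in> borel_measurable M"
    unfolding V_def[abs_def] by (rule borel_measurable_add[OF borel_measurable_add[OF m3 m4] m5])

  have pU1: "past n (lin ?c (trunc D ?h B) n)" and pU2: "past n (quad p ?a ?a n)"
    by (intro past_lin past_quad C.trunc_measurable I.trunc_measurable order_refl)+
  have iU1: "integrable M (\<lambda>\<omega>. U1 \<omega> ^ 4)"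
    unfolding U1_def by (intro past_integrable_power[OF pU1] lin_bounded[OF C.trunc_bound] order_refl)
  have iU2: "integrable M (\<lambda>\<omega>. U2 \<omega> ^ 4)"
    unfolding U2_def power_mult_distrib
    by (intro integrable_mult_right past_integrable_power[OF pU2]
        quad_bounded[OF I.trunc_bound I.trunc_bound] order_refl)
  have "(\<integral>\<omega>. U1 \<omega> ^ 4 \<partial>M) \<le> (4 * (2 * B)\<^sup>2 * (\<Sum>i<n. (?c i)\<^sup>2))\<^sup>2"
    unfolding U1_def by (rule lin_fourth_moment[OF C.trunc_measurable C.trunc_bound C.trunc_centred order_refl])
  also have "\<dots> \<le> (4 * (2 * B)\<^sup>2 * r)\<^sup>2"
    by (intro power_mono mult_left_mono diag(3)) (auto simp: sum_nonneg)
  also have "\<dots> = 2 ^ 8 * B ^ 4 * r\<^sup>2"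
    by (simp add: power_mult_distrib flip: power_mult)
  \<comment> \<open>\<open>1 \<le> B\<close> raises the power to the one produced by the quadratic
    form, so that the two bounds can be added.\<close>
  also have "\<dots> \<le> 2 ^ 8 * B ^ 8 * r\<^sup>2"
    using B by (intro mult_left_mono mult_right_mono power_increasing) auto
  finally have U14: "(\<integral>\<omega>. U1 \<omega> ^ 4 \<partial>M) \<le> 2 ^ 8 * B ^ 8 * r\<^sup>2" .
  have "(\<integral>\<omega>. quad p ?a ?a n (Z \<omega>) ^ 4 \<partial>M) \<le> (16 * (2 * B) ^ 4 * (\<Sum>j<n. \<Sum>i<j. (p j i)\<^sup>2))\<^sup>2"
    by (rule quad_fourth_moment[OF I.trunc_measurable I.trunc_bound I.trunc_centred order_refl])
  also have "\<dots> \<le> (16 * (2 * B) ^ 4 * r)\<^sup>2"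
    by (intro power_mono mult_left_mono off_diag) (auto simp: sum_nonneg)
  also have "\<dots> = 2 ^ 16 * B ^ 8 * r\<^sup>2"
    by (simp add: power_mult_distrib flip: power_mult)
  \<comment> \<open>The coefficient 2 in \<open>U2\<close> contributes \<open>2 ^ 4\<close>.\<close>
  finally have U24: "(\<integral>\<omega>. U2 \<omega> ^ 4 \<partial>M) \<le> 2 ^ 20 * B ^ 8 * r\<^sup>2"
    unfolding U2_def by (simp add: power_mult_distrib mult_ac)
  have four: "(x + y) ^ 4 \<le> 8 * x ^ 4 + 8 * y ^ 4" for x y :: real
  proof -
    have 2: "(x + y)\<^sup>2 \<le> 2 * x\<^sup>2 + 2 * y\<^sup>2" for x y :: real
      using sum_squares_bound[of x y] by (simp add: power2_sum)
    have "((x + y)\<^sup>2)\<^sup>2 \<le> (2 * x\<^sup>2 + 2 * y\<^sup>2)\<^sup>2" using 2 by (intro power_mono) auto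
    also have "\<dots> \<le> 2 * (2 * x\<^sup>2)\<^sup>2 + 2 * (2 * y\<^sup>2)\<^sup>2" by (rule 2)
    finally show ?thesis by (simp add: power_mult_distrib flip: power_mult)
  qed
  have iU: "integrable M (\<lambda>\<omega>. U \<omega> ^ 4)"
  proof (rule Bochner_Integration.integrable_bound)
    show "integrable M (\<lambda>\<omega>. 8 * U1 \<omega> ^ 4 + 8 * U2 \<omega> ^ 4)"
      by (intro Bochner_Integration.integrable_add integrable_mult_right iU1 iU2)
    show "(\<lambda>\<omega>. U \<omega> ^ 4) \<in> borel_measurable M"
      by (rule borel_measurable_power[OF mU])
    show "AE \<omega> in M. norm (U \<omega> ^ 4) \<le> norm (8 * U1 \<omega> ^ 4 + 8 * U2 \<omega> ^ 4)"
      using four unfolding U_def by (intro AE_I2) simp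
  qed
  have "(\<integral>\<omega>. U \<omega> ^ 4 \<partial>M) \<le> (\<integral>\<omega>. 8 * U1 \<omega> ^ 4 + 8 * U2 \<omega> ^ 4 \<partial>M)"
    unfolding U_def using four
    by (intro integral_mono Bochner_Integration.integrable_add integrable_mult_right iU1 iU2
        iU[unfolded U_def])
  also have "\<dots> = 8 * (\<integral>\<omega>. U1 \<omega> ^ 4 \<partial>M) + 8 * (\<integral>\<omega>. U2 \<omega> ^ 4 \<partial>M)"
    using iU1 iU2 by simp
  also have "\<dots> \<le> 8 * (2 ^ 8 * B ^ 8 * r\<^sup>2) + 8 * (2 ^ 20 * B ^ 8 * r\<^sup>2)"
    by (intro add_mono mult_left_mono U14 U24) auto
  \<comment> \<open>\<open>2 ^ 11 + 2 ^ 23\<close> is below \<open>2 ^ 24\<close>; halving the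
    threshold below turns this into \<open>2 ^ 28\<close>.\<close>
  also have "\<dots> \<le> 2 ^ 24 * (B ^ 8 * r\<^sup>2)"
    using B0 by simp
  finally have U4: "(\<integral>\<omega>. U \<omega> ^ 4 \<partial>M) \<le> 2 ^ 24 * (B ^ 8 * r\<^sup>2)" .
  have t2: "0 < t / 2" using t by simp
  have "prob {\<omega> \<in> space M. t / 2 \<le> \<bar>U \<omega>\<bar>} \<le> 2 ^ 24 * (B ^ 8 * r\<^sup>2) / (t / 2) ^ 4"
    using iU U4 by (intro prob_abs_ge_le t2 mU mV) simp_all
  then have pU: "prob {\<omega> \<in> space M. t / 2 \<le> \<bar>U \<omega>\<bar>} \<le> 2 ^ 28 * B ^ 8 * r\<^sup>2 / t ^ 4"
    by (simp add: power_divide)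

  note a2 = I.integrable_trunc_square[OF second_moment]
  note b2 = I.integrable_rest_square[OF second_moment]
  note n1 = lin_second_moment[OF C.rest_measurable C.integrable_rest_square[OF h2] C.rest_centred order_refl, of ?c]
  note n2 = quad_second_moment[OF id second_moment mean I.rest_measurable b2 I.rest_centred order_refl, of p]
  note n3 = quad_second_moment[OF I.rest_measurable b2 I.rest_centred I.trunc_measurable a2 I.trunc_centred order_refl, of p]
  have iV: "integrable M (\<lambda>\<omega>. (V1 \<omega>)\<^sup>2)" "integrable M (\<lambda>\<omega>. (V2 \<omega>)\<^sup>2)" "integrable M (\<lambda>\<omega>. (V3 \<omega>)\<^sup>2)"
    using n1(1) n2(1) n3(1) by (auto simp: V1_def V2_def V3_def power_mult_distrib)
  have V12: "(\<integral>\<omega>. (V1 \<omega>)\<^sup>2 \<partial>M) \<le> tail D ?h 2 B * r"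
    unfolding V1_def n1(2)
    by (intro mult_mono C.rest_second_moment[OF h2] diag(3) tail_nonneg) (auto simp: sum_nonneg)
  have V22: "(\<integral>\<omega>. (V2 \<omega>)\<^sup>2 \<partial>M) \<le> 4 * (tail D (\<lambda>x. x) 2 B * r)"
    using mult_mono[OF I.rest_second_moment[OF second_moment] off_diag tail_nonneg] n2(2) variance
    by (simp add: V2_def power_mult_distrib sum_nonneg)
  \<comment> \<open>Truncation with recentring does not increase the second moment, so the factor
    from \<open>?a\<close> is at most 1.\<close>
  have "(\<integral>x. (?b x)\<^sup>2 \<partial>D) * (\<integral>x. (?a x)\<^sup>2 \<partial>D) \<le> tail D (\<lambda>x. x) 2 B * 1"
    using I.trunc_second_moment[OF second_moment] variance
    by (intro mult_mono I.rest_second_moment[OF second_moment] tail_nonneg) auto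
  then have V32: "(\<integral>\<omega>. (V3 \<omega>)\<^sup>2 \<partial>M) \<le> 4 * (tail D (\<lambda>x. x) 2 B * r)"
    using mult_mono[OF _ off_diag tail_nonneg] n3(2)
    by (simp add: V3_def power_mult_distrib sum_nonneg)
  have three: "(x + y + z)\<^sup>2 \<le> 3 * x\<^sup>2 + 3 * y\<^sup>2 + 3 * z\<^sup>2" for x y z :: real
    using sum_squares_bound[of x y] sum_squares_bound[of x z] sum_squares_bound[of y z]
    by (simp add: power2_eq_square algebra_simps)
  have iVV: "integrable M (\<lambda>\<omega>. (V \<omega>)\<^sup>2)"
    unfolding V_def by (intro integrable_power2_add borel_measurable_add m3 m4 m5 iV)
  have "(\<integral>\<omega>. (V \<omega>)\<^sup>2 \<partial>M) \<le> (\<integral>\<omega>. 3 * (V1 \<omega>)\<^sup>2 + 3 * (V2 \<omega>)\<^sup>2 + 3 * (V3 \<omega>)\<^sup>2 \<partial>M)"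
    unfolding V_def using three
    by (intro integral_mono Bochner_Integration.integrable_add integrable_mult_right iV
        iVV[unfolded V_def])
  also have "\<dots> \<le> (3 * tail D ?h 2 B + 24 * tail D (\<lambda>x. x) 2 B) * r"
    using iV V12 V22 V32 by (simp add: algebra_simps)
  finally have VV: "(\<integral>\<omega>. (V \<omega>)\<^sup>2 \<partial>M) \<le> (3 * tail D ?h 2 B + 24 * tail D (\<lambda>x. x) 2 B) * r" .
  have "prob {\<omega> \<in> space M. t / 2 \<le> \<bar>V \<omega>\<bar>} \<le> (3 * tail D ?h 2 B + 24 * tail D (\<lambda>x. x) 2 B) * r / (t / 2)\<^sup>2"
    using iVV VV by (intro prob_abs_ge_le t2 mU mV) simp_all
  then have pV: "prob {\<omega> \<in> space M. t / 2 \<le> \<bar>V \<omega>\<bar>}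
      \<le> (12 * tail D ?h 2 B + 96 * tail D (\<lambda>x. x) 2 B) * r / t\<^sup>2"
    by (simp add: power_divide algebra_simps)

  show ?thesis
    unfolding dev using prob_abs_add_ge_le[OF mU mV, of t] pU pV by linarith
qed

text \<open>
  The truncation levels \<open>r powr (1/8)\<close> and \<open>r powr (1/32)\<close> tend to infinity slowly enough for the
  moments of the truncated parts to be negligible.
\<close>

lemma deviation_rate:
  defines "\<tau> \<equiv> tail D (\<lambda>x. x\<^sup>2 - 1) 1 (r powr (1/8))"
  shows "prob {\<omega> \<in> space M. min 1 (sqrt \<tau> + r powr (-1/8)) * r \<le> \<bar>dev \<omega>\<bar>}
    \<le> 36 * (r powr (1/4) + 1) / r powr (3/4) + 6 * (\<tau> + sqrt \<tau>)"
proof -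
  define e where "e = r powr (-1/8)"
  \<comment> \<open>The minimum keeps the rate in \<open>{0..1}\<close>, the summand
    \<open>e\<close> keeps \<open>s\<close> positive when \<open>\<tau> = 0\<close>, and
    \<open>sqrt \<tau>\<close> makes \<open>\<tau> / s\<close> small.\<close>
  define s where "s = min 1 (sqrt \<tau> + e)"
  have e: "0 < e" "e \<le> 1" using r powr_mono[of "-1/8" 0 r] by (auto simp: e_def)
  have t0: "0 \<le> \<tau>" unfolding \<tau>_def by (rule tail_nonneg)
  have s: "0 < s" "e \<le> s" using e t0 by (auto simp: s_def add_nonneg_pos)
  have "r powr (3/4) = e\<^sup>2 * r"
    using r powr_add[of r "-1/4" 1] unfolding e_def by (simp add: power2_eq_square flip: powr_add)
  also have "\<dots> \<le> s\<^sup>2 * r" using s e r by (intro mult_right_mono power_mono) auto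
  finally have 1: "r powr (3/4) \<le> s\<^sup>2 * r" .
  have b: "(r powr (1/8))\<^sup>2 = r powr (1/4)"
    using r by (simp add: power2_eq_square flip: powr_add)
  \<comment> \<open>The two summands cover the two values of the minimum: \<open>\<tau>\<close> when
    \<open>s = 1\<close>, and \<open>sqrt \<tau>\<close> when \<open>s\<close> is at least
    \<open>sqrt \<tau>\<close>.\<close>
  have ts: "\<tau> / s \<le> \<tau> + sqrt \<tau>"
  proof (cases "s = 1")
    case True
    then show ?thesis using t0 by simp
  next
    case False
    then have "sqrt \<tau> \<le> s" using e by (auto simp: s_def)
    then have "\<tau> \<le> sqrt \<tau> * s"
      using mult_left_mono[of "sqrt \<tau>" s "sqrt \<tau>"] t0 by simp
    then have "\<tau> / s \<le> sqrt \<tau>" using s by (simp add: divide_le_eq)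
    then show ?thesis using t0 by simp
  qed
  have "prob {\<omega> \<in> space M. s * r \<le> \<bar>dev \<omega>\<bar>}
      \<le> 36 * ((r powr (1/8))\<^sup>2 + 1) / (s\<^sup>2 * r) + 6 * \<tau> / s"
    unfolding \<tau>_def by (rule deviation_second_moment[OF _ s(1)]) simp
  also have "\<dots> \<le> 36 * (r powr (1/4) + 1) / r powr (3/4) + 6 * (\<tau> + sqrt \<tau>)"
    unfolding b using 1 ts r s by (intro add_mono divide_left_mono) auto
  finally show ?thesis unfolding s_def e_def .
qed

text \<open>One factor \<open>r / t\<^sup>2\<close> of the fourth moment bound is kept; the other is
  at most \<open>r powr (-1/2)\<close> because \<open>t\<close> is at least
  \<open>r powr (3/4)\<close>. Against \<open>B ^ 8 = r powr (1/4)\<close> this leaves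
  \<open>r powr (-1/4)\<close>.\<close>

lemma deviation_rate_fourth_moment:
  assumes i4: "integrable D (\<lambda>x. x ^ 4)" and t: "0 < t" "r powr (-1/4) * r \<le> t"
  shows "prob {\<omega> \<in> space M. t \<le> \<bar>dev \<omega>\<bar>}
    \<le> (2 ^ 28 * r powr (-1/4) + (12 * tail D (\<lambda>x. x\<^sup>2 - 1) 2 (r powr (1/32))
        + 96 * tail D (\<lambda>x. x) 2 (r powr (1/32)))) * r / t\<^sup>2"
proof -
  define \<delta> where "\<delta> = 12 * tail D (\<lambda>x. x\<^sup>2 - 1) 2 (r powr (1/32)) + 96 * tail D (\<lambda>x. x) 2 (r powr (1/32))"
  have B: "1 \<le> r powr (1/32)" using r by (simp add: ge_one_powr_ge_zero)
  have b: "(r powr (1/32)) ^ 8 = r powr (1/4)"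
    using r by (simp add: powr_power)
  have "(r powr (-1/4) * r)\<^sup>2 \<le> t\<^sup>2" using t r by (intro power_mono) auto
  moreover have "(r powr (-1/4) * r)\<^sup>2 = r powr (1/2) * r"
    using r by (simp add: power_mult_distrib powr_power) (simp add: power2_eq_square powr_mult_base powr_add[of r "-1/2" 1, simplified])
  ultimately have "r powr (1/2) * r \<le> t\<^sup>2" by simp
  then have "r / t\<^sup>2 \<le> r / (r powr (1/2) * r)"
    using r t by (intro divide_left_mono) auto
  also have "\<dots> = r powr (-1/2)"
    using r by (simp add: powr_minus_divide)
  finally have rt: "r / t\<^sup>2 \<le> r powr (-1/2)" .
  have "2 ^ 28 * r powr (1/4) * r\<^sup>2 / t ^ 4 = 2 ^ 28 * r powr (1/4) * (r / t\<^sup>2) * (r / t\<^sup>2)"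
    by (simp add: power4_eq_xxxx power2_eq_square)
  also have "\<dots> \<le> 2 ^ 28 * r powr (1/4) * r powr (-1/2) * (r / t\<^sup>2)"
    using rt r by (intro mult_right_mono mult_left_mono) auto
  also have "\<dots> = 2 ^ 28 * r powr (-1/4) * (r / t\<^sup>2)"
    using r by (simp flip: powr_add)
  finally have "2 ^ 28 * r powr (1/4) * r\<^sup>2 / t ^ 4 + \<delta> * r / t\<^sup>2 \<le> (2 ^ 28 * r powr (-1/4) + \<delta>) * r / t\<^sup>2"
    by (simp add: distrib_right add_divide_distrib)
  then show ?thesis
    using deviation_fourth_moment[OF i4 B t(1)] unfolding b \<delta>_def by linarith
qed

end

section \<open>Passage from random vectors and projections to the abstract forms\<close>

lemma iid_array_sample:
  assumes M: "prob_space M" and X: "iid_array M X D" and D: "prob_space D" "sets D = sets borel"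
    and n: "1 \<le> n"
  shows "iid_sample M n (\<lambda>i \<omega>. X n \<omega> $ i) D"
proof -
  interpret prob_space M by (rule M)
  let ?X = "\<lambda>(n, k) \<omega>. X n \<omega> $ k"
  have ind: "indep_vars (\<lambda>_. borel) ?X {(n, k). 1 \<le> n \<and> k < n}"
    and dist: "\<And>k. k < n \<Longrightarrow> distr M borel (\<lambda>\<omega>. X n \<omega> $ k) = D"
    using X n by (auto simp: iid_array_def)
  \<comment> \<open>Row \<open>n\<close> is extracted by grouping the array into singleton blocks
    indexed by the column; evaluating each block at its only index then recovers the
    coordinates.\<close>
  have "indep_vars (\<lambda>j. Pi\<^sub>M {(n, j)} (\<lambda>_. borel)) (\<lambda>j \<omega>. restrict (\<lambda>i. ?X i \<omega>) {(n, j)}) {..<n}"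
    using n by (intro indep_vars_restrict[OF ind]) (auto simp: disjoint_family_on_def)
  moreover have "(\<lambda>z. z (n, j)) \<in> measurable (Pi\<^sub>M {(n, j)} (\<lambda>_. borel)) borel" for j
    by (rule measurable_component_singleton) simp
  ultimately have "indep_vars (\<lambda>_. borel) (\<lambda>j \<omega>. restrict (\<lambda>i. ?X i \<omega>) {(n, j)} (n, j)) {..<n}"
    by (rule indep_vars_compose2)
  then have "indep_vars (\<lambda>_. borel) (\<lambda>i \<omega>. X n \<omega> $ i) {..<n}"
    by simp
  then show ?thesis
    using dist D M by (simp add: iid_sample_def iid_sample_axioms_def)
qed

lemma scalar_prod_eq_lin:
  assumes "x \<in> carrier_vec n" "y \<in> carrier_vec n"
  shows "x \<bullet> y = lin (\<lambda>i. y $ i) (\<lambda>x. x) n (\<lambda>i. x $ i)"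
  using assms by (auto simp: scalar_prod_def lin_def atLeast0LessThan mult.commute intro!: sum.cong)

text \<open>Writing the rank as the trace centres the squares on the diagonal, and symmetry folds
  the off-diagonal part. The result is the expression \<open>dev\<close> of the tail bounds.\<close>

lemma orthogonal_projection_deviation:
  assumes P: "orthogonal_projection n P" and x: "x \<in> carrier_vec n"
  shows "(euclid_norm (P *\<^sub>v x))\<^sup>2 - real (vec_space.rank n P)
    = lin (\<lambda>i. P $$ (i,i)) (\<lambda>x. x\<^sup>2 - 1) n (\<lambda>i. x $ i)
      + 2 * quad (\<lambda>i j. P $$ (i,j)) (\<lambda>x. x) (\<lambda>x. x) n (\<lambda>i. x $ i)"
proof -
  have "(euclid_norm (P *\<^sub>v x))\<^sup>2 = (\<Sum>i<n. P $$ (i,i) * (x $ i)\<^sup>2)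
      + 2 * quad (\<lambda>i j. P $$ (i,j)) (\<lambda>x. x) (\<lambda>x. x) n (\<lambda>i. x $ i)"
    unfolding orthogonal_projection_norm[OF P x]
    by (rule symmetric_form_eq) (rule orthogonal_projection_symmetric[OF P])
  then show ?thesis
    unfolding orthogonal_projection_trace[OF P, symmetric]
    by (simp add: lin_def right_diff_distrib sum_subtractf)
qed

lemma orthogonal_projection_quadratic_form:
  assumes Y: "iid_sample M n Y D"
    and D: "integrable D (\<lambda>x. x\<^sup>2)" "(\<integral>x. x \<partial>D) = 0" "(\<integral>x. x\<^sup>2 \<partial>D) = 1"
    and P: "orthogonal_projection n P" "P \<noteq> 0\<^sub>m n n"
  shows "quadratic_form M n Y D (\<lambda>i j. P $$ (i,j)) (real (vec_space.rank n P))"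
proof -
  interpret iid_sample M n Y D by (rule Y)
  show ?thesis
    using D orthogonal_projection_diag_bounds(1)[OF P(1)] orthogonal_projection_trace[OF P(1)]
      orthogonal_projection_diag_squares[OF P(1)] orthogonal_projection_lower_triangle[OF P(1)]
      orthogonal_projection_rank_pos[OF P]
    by unfold_locales auto
qed

theorem proposition1p4:
  fixes M :: "'a measure" and N :: "'b measure"
    and \<xi> :: "'b \<Rightarrow> real" and X :: "nat \<Rightarrow> 'a \<Rightarrow> real Matrix.vec"
  assumes "prob_space M" and "prob_space N"
    and "\<xi> \<in> borel_measurable N"
    and "integrable N \<xi>" and "integrable N (\<lambda>\<omega>. (\<xi> \<omega>)\<^sup>2)"
    and "prob_space.expectation N \<xi> = 0" and "prob_space.variance N \<xi> = 1"
    and "iid_array M X (distr N borel \<xi>)"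
  shows
    "(((\<lambda>K::real. SUP (n, y) \<in> (SIGMA n:{1..}. unit_sphere n).
          \<integral>\<^sup>+\<omega>. ennreal ((X n \<omega> \<bullet> y)\<^sup>2 * indicator {\<omega>. (X n \<omega> \<bullet> y)\<^sup>2 \<ge> K} \<omega>) \<partial>M)
        \<longlongrightarrow> 0) at_top
      \<and> (\<exists>f g. rate_pair f g \<and>
           (\<forall>n\<ge>1. \<forall>P. orthogonal_projection n P \<and> P \<noteq> 0\<^sub>m n n \<longrightarrow>
              (let r = vec_space.rank n P in
                 \<P>(\<omega> in M. \<bar>(euclid_norm (P *\<^sub>v X n \<omega>))\<^sup>2 - real r\<bar> \<ge> f r * real r) \<le> g r))))
     \<and> (integrable N (\<lambda>\<omega>. (\<xi> \<omega>) ^ 4) \<longrightarrow>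
         (\<exists>f g. rate_pair f g \<and>
           (\<forall>n\<ge>1. \<forall>P. orthogonal_projection n P \<and> P \<noteq> 0\<^sub>m n n \<longrightarrow>
              (let r = vec_space.rank n P in
                 \<forall>t::real. t \<ge> f r * real r \<and> t \<noteq> 0 \<longrightarrow>
                   \<P>(\<omega> in M. \<bar>(euclid_norm (P *\<^sub>v X n \<omega>))\<^sup>2 - real r\<bar> \<ge> t)
                     \<le> g r * real r / t\<^sup>2))))"
proof -
  interpret M: prob_space M by fact
  interpret N: prob_space N by fact
  note \<xi> [measurable] = \<open>\<xi> \<in> borel_measurable N\<close>
  \<comment> \<open>\<open>\<xi>\<close> and \<open>X\<close> live on different probability spaces,
    so the moment hypotheses are moved to the common law on the reals.\<close>
  define D where "D = distr N borel \<xi>"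
  have D: "prob_space D" "sets D = sets borel"
    unfolding D_def by (simp_all add: N.prob_space_distr)
  interpret D: prob_space D by (rule D)
  have D_int: "(\<integral>x. h x \<partial>D) = (\<integral>\<omega>. h (\<xi> \<omega>) \<partial>N)" if "h \<in> borel_measurable borel" for h :: "real \<Rightarrow> real"
    unfolding D_def using that by (intro integral_distr) auto
  have D_integrable: "integrable D h \<longleftrightarrow> integrable N (\<lambda>\<omega>. h (\<xi> \<omega>))"
    if "h \<in> borel_measurable borel" for h :: "real \<Rightarrow> real"
    unfolding D_def using that by (intro integrable_distr_eq) auto
  have D2: "integrable D (\<lambda>x. x\<^sup>2)" using assms(5) by (simp add: D_integrable)
  have D0: "(\<integral>x. x \<partial>D) = 0" using assms(6) by (simp add: D_int)
  have Dv: "(\<integral>x. x\<^sup>2 \<partial>D) = 1" using assms(6,7) by (simp add: D_int)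
  have X: "iid_array M X D" using assms(8) by (simp add: D_def)
  have Xc: "X n \<omega> \<in> carrier_vec n" if "1 \<le> n" "\<omega> \<in> space M" for n \<omega>
    using X that by (auto simp: iid_array_def)
  have sample: "iid_sample M n (\<lambda>i \<omega>. X n \<omega> $ i) D" if "1 \<le> n" for n
    by (rule iid_array_sample[OF assms(1) X D that])
  have form: "quadratic_form M n (\<lambda>i \<omega>. X n \<omega> $ i) D (\<lambda>i j. P $$ (i,j)) (real (vec_space.rank n P))"
    if "1 \<le> n" "orthogonal_projection n P" "P \<noteq> 0\<^sub>m n n" for n P
    by (rule orthogonal_projection_quadratic_form[OF sample[OF that(1)] D2 D0 Dv that(2,3)])
  have prob_eq: "\<P>(\<omega> in M. t \<le> \<bar>(euclid_norm (P *\<^sub>v X n \<omega>))\<^sup>2 - real (vec_space.rank n P)\<bar>)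
      = M.prob {\<omega> \<in> space M. t \<le> \<bar>lin (\<lambda>i. P $$ (i,i)) (\<lambda>x. x\<^sup>2 - 1) n (\<lambda>i. X n \<omega> $ i)
          + 2 * quad (\<lambda>i j. P $$ (i,j)) (\<lambda>x. x) (\<lambda>x. x) n (\<lambda>i. X n \<omega> $ i)\<bar>}"
    if "1 \<le> n" "orthogonal_projection n P" for n P t
    using orthogonal_projection_deviation[OF that(2) Xc[OF that(1)]]
    by (intro arg_cong[where f = M.prob]) auto
  have tail1: "(tail D (\<lambda>x. x\<^sup>2 - 1) 1 \<longlongrightarrow> 0) at_top"
    using D2 by (intro tail_tendsto_0) (auto simp: D(2) measurable_cong_sets[OF D(2) refl])
  have tail2: "(tail D (\<lambda>x. x) 2 \<longlongrightarrow> 0) at_top"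
    using D2 by (intro tail_tendsto_0) (auto simp: D(2) measurable_cong_sets[OF D(2) refl])

  have ui: "((\<lambda>K::real. SUP (n, y) \<in> (SIGMA n:{1..}. unit_sphere n).
          \<integral>\<^sup>+\<omega>. ennreal ((X n \<omega> \<bullet> y)\<^sup>2 * indicator {\<omega>. (X n \<omega> \<bullet> y)\<^sup>2 \<ge> K} \<omega>) \<partial>M)
        \<longlongrightarrow> 0) at_top" (is "(?S \<longlongrightarrow> 0) at_top")
  proof (rule tendsto_sandwich[where f = "\<lambda>_. 0"])
    \<comment> \<open>Truncation at \<open>B = K powr (1/8)\<close> makes \<open>B ^ 4 / K\<close>
      equal to \<open>K powr (-1/2)\<close> for positive \<open>K\<close>, while \<open>B\<close>
      still tends to infinity.\<close>
    let ?F = "\<lambda>K::real. 4096 * (K powr (1/8)) ^ 4 / K + 4 * tail D (\<lambda>x. x) 2 (K powr (1/8))"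
    have "((\<lambda>K::real. 4096 * (K powr (1/8)) ^ 4 / K) \<longlongrightarrow> 0) at_top" by real_asymp
    moreover have "filterlim (\<lambda>K::real. K powr (1/8)) at_top at_top" by real_asymp
    ultimately have "(?F \<longlongrightarrow> 0 + 4 * 0) at_top"
      by (intro tendsto_add tendsto_mult_left filterlim_compose[OF tail2])
    then show "((\<lambda>K. ennreal (?F K)) \<longlongrightarrow> 0) at_top"
      using tendsto_ennrealI by fastforce
    show "\<forall>\<^sub>F K in at_top. ?S K \<le> ennreal (?F K)"
      using eventually_gt_at_top[of 0]
    proof eventually_elim
      case (elim K)
      show ?case
      proof (rule SUP_least)
        fix ny assume "ny \<in> (SIGMA n:{1..}. unit_sphere n)"
        then obtain n y where ny: "ny = (n, y)" and "n \<in> {1..}" and "y \<in> unit_sphere n"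
          by auto
        then have n: "1 \<le> n" and y: "y \<in> carrier_vec n" and y1: "y \<bullet> y = 1"
          by (auto simp: unit_sphere_def euclid_norm_def)
        interpret iid_sample M n "\<lambda>i \<omega>. X n \<omega> $ i" D by (rule sample[OF n])
        have c: "(\<Sum>i<n. (y $ i)\<^sup>2) = 1"
          using y y1 by (simp add: scalar_prod_def atLeast0LessThan power2_eq_square)
        have "(\<integral>\<^sup>+\<omega>. ennreal ((X n \<omega> \<bullet> y)\<^sup>2 * indicator {\<omega>. (X n \<omega> \<bullet> y)\<^sup>2 \<ge> K} \<omega>) \<partial>M)
          = (\<integral>\<^sup>+\<omega>. ennreal ((lin (\<lambda>i. y $ i) (\<lambda>x. x) n (\<lambda>i. X n \<omega> $ i))\<^sup>2
              * indicator {\<omega>. K \<le> (lin (\<lambda>i. y $ i) (\<lambda>x. x) n (\<lambda>i. X n \<omega> $ i))\<^sup>2} \<omega>) \<partial>M)"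
          using scalar_prod_eq_lin[OF Xc[OF n] y]
          by (intro nn_integral_cong) (simp add: indicator_def)
        also have "\<dots> \<le> ennreal (?F K)"
          using c elim D0 D2 by (intro lin_uniform_integrability) auto
        finally show "(case ny of (n, y) \<Rightarrow> \<integral>\<^sup>+\<omega>. ennreal ((X n \<omega> \<bullet> y)\<^sup>2
            * indicator {\<omega>. (X n \<omega> \<bullet> y)\<^sup>2 \<ge> K} \<omega>) \<partial>M) \<le> ennreal (?F K)"
          by (simp add: ny)
      qed
    qed
  qed auto

  define \<tau> where "\<tau> r = tail D (\<lambda>x. x\<^sup>2 - 1) 1 (real r powr (1/8))" for r :: nat
  define f1 where "f1 r = min 1 (sqrt (\<tau> r) + real r powr (-1/8))" for r
  define g1 where "g1 r = 36 * (real r powr (1/4) + 1) / real r powr (3/4) + 6 * (\<tau> r + sqrt (\<tau> r))" for r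
  have "filterlim (\<lambda>r::nat. real r powr (1/8)) at_top sequentially" by real_asymp
  from filterlim_compose[OF tail1 this] have \<tau>: "\<tau> \<longlonglongrightarrow> 0" by (simp add: \<tau>_def[abs_def])
  have \<tau>0: "0 \<le> \<tau> r" for r by (simp add: \<tau>_def tail_nonneg)
  have e: "(\<lambda>r::nat. real r powr (-1/8)) \<longlonglongrightarrow> 0"
    "(\<lambda>r::nat. 36 * (real r powr (1/4) + 1) / real r powr (3/4)) \<longlonglongrightarrow> 0" by real_asymp+
  have "f1 \<longlonglongrightarrow> min 1 (sqrt 0 + 0)" unfolding f1_def[abs_def]
    by (intro tendsto_min tendsto_const tendsto_add tendsto_real_sqrt \<tau> e)
  moreover have "g1 \<longlonglongrightarrow> 0 + 6 * (0 + sqrt 0)" unfolding g1_def[abs_def]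
    by (intro tendsto_add tendsto_mult_left tendsto_real_sqrt \<tau> e)
  ultimately have rate1: "rate_pair f1 g1"
    using \<tau>0 by (auto simp: rate_pair_def f1_def g1_def)
  have part1: "\<exists>f g. rate_pair f g \<and>
           (\<forall>n\<ge>1. \<forall>P. orthogonal_projection n P \<and> P \<noteq> 0\<^sub>m n n \<longrightarrow>
              (let r = vec_space.rank n P in
                 \<P>(\<omega> in M. \<bar>(euclid_norm (P *\<^sub>v X n \<omega>))\<^sup>2 - real r\<bar> \<ge> f r * real r) \<le> g r))"
  proof (rule exI[of _ f1], rule exI[of _ g1], intro conjI rate1 allI impI)
    fix n :: nat and P assume n: "1 \<le> n" and P: "orthogonal_projection n P \<and> P \<noteq> 0\<^sub>m n n"
    then interpret quadratic_form M n "\<lambda>i \<omega>. X n \<omega> $ i" D "\<lambda>i j. P $$ (i,j)" "real (vec_space.rank n P)"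
      by (intro form) auto
    show "let r = vec_space.rank n P in
        \<P>(\<omega> in M. \<bar>(euclid_norm (P *\<^sub>v X n \<omega>))\<^sup>2 - real r\<bar> \<ge> f1 r * real r) \<le> g1 r"
      using deviation_rate prob_eq[OF n] P by (simp add: Let_def f1_def g1_def \<tau>_def)
  qed

  have part2: "\<exists>f g. rate_pair f g \<and>
           (\<forall>n\<ge>1. \<forall>P. orthogonal_projection n P \<and> P \<noteq> 0\<^sub>m n n \<longrightarrow>
              (let r = vec_space.rank n P in
                 \<forall>t::real. t \<ge> f r * real r \<and> t \<noteq> 0 \<longrightarrow>
                   \<P>(\<omega> in M. \<bar>(euclid_norm (P *\<^sub>v X n \<omega>))\<^sup>2 - real r\<bar> \<ge> t)
                     \<le> g r * real r / t\<^sup>2))"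
    if "integrable N (\<lambda>\<omega>. (\<xi> \<omega>) ^ 4)"
  proof -
    have D4: "integrable D (\<lambda>x. x ^ 4)" using that by (simp add: D_integrable)
    then have "integrable D (\<lambda>x. (x\<^sup>2 - 1)\<^sup>2)"
      using D2 by (simp add: power2_diff flip: power_mult)
    then have tail3: "(tail D (\<lambda>x. x\<^sup>2 - 1) 2 \<longlongrightarrow> 0) at_top"
      by (intro tail_tendsto_0) (auto simp: measurable_cong_sets[OF D(2) refl])
    \<comment> \<open>Thus \<open>f2 r * r\<close> is the threshold \<open>r powr (3/4)\<close>, and
      \<open>g2\<close> is the coefficient of \<open>r / t\<^sup>2\<close> in the fourth moment
      bound.\<close>
    define f2 where "f2 r = real r powr (-1/4)" for r :: nat
    define g2 where "g2 r = 2 ^ 28 * real r powr (-1/4) + (12 * tail D (\<lambda>x. x\<^sup>2 - 1) 2 (real r powr (1/32))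
        + 96 * tail D (\<lambda>x. x) 2 (real r powr (1/32)))" for r :: nat
    have f2: "f2 \<longlonglongrightarrow> 0" unfolding f2_def[abs_def] by real_asymp
    have B: "filterlim (\<lambda>r::nat. real r powr (1/32)) at_top sequentially" by real_asymp
    have "g2 \<longlonglongrightarrow> 2 ^ 28 * 0 + (12 * 0 + 96 * 0)" unfolding g2_def[abs_def]
      by (intro tendsto_add tendsto_mult_left f2[unfolded f2_def[abs_def]]
          filterlim_compose[OF tail2 B] filterlim_compose[OF tail3 B])
    then have rate2: "rate_pair f2 g2"
      using f2 powr_mono[of "-1/4" 0] by (auto simp: rate_pair_def f2_def g2_def tail_nonneg)
    show ?thesis
    proof (rule exI[of _ f2], rule exI[of _ g2], intro conjI rate2 allI impI)
      fix n :: nat and P assume n: "1 \<le> n" and P: "orthogonal_projection n P \<and> P \<noteq> 0\<^sub>m n n"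
      then interpret quadratic_form M n "\<lambda>i \<omega>. X n \<omega> $ i" D "\<lambda>i j. P $$ (i,j)" "real (vec_space.rank n P)"
        by (intro form) auto
      \<comment> \<open>The threshold is nonnegative, so leaving out \<open>t = 0\<close> leaves
        only positive \<open>t\<close>, as the tail bound requires.\<close>
      have pos: "0 < t" if "f2 (vec_space.rank n P) * real (vec_space.rank n P) \<le> t" "t \<noteq> 0" for t
      proof -
        have "0 \<le> f2 (vec_space.rank n P) * real (vec_space.rank n P)" by (simp add: f2_def)
        then show ?thesis using that by linarith
      qed
      show "let r = vec_space.rank n P in
                 \<forall>t::real. t \<ge> f2 r * real r \<and> t \<noteq> 0 \<longrightarrow>
                   \<P>(\<omega> in M. \<bar>(euclid_norm (P *\<^sub>v X n \<omega>))\<^sup>2 - real r\<bar> \<ge> t)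
                     \<le> g2 r * real r / t\<^sup>2"
        using deviation_rate_fourth_moment[OF D4] pos prob_eq[OF n] P
        by (simp add: Let_def f2_def g2_def)
    qed
  qed
  show ?thesis using ui part1 part2 by blast
qed

end
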